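(* Let $d\ge 1$, $N\ge 2$, and let $X:(\Omega,\mathcal A,\mathbb P)\to\mathbb R^d$ be a square integrable random vector whose distribution $\mu$ has a convex support $\mathbf U=\operatorname{supp}(\mu)$ and assigns no mass to hyperplanes. Let $\Gamma^{(0)}\subset\mathbf U$ with size $|\Gamma^{(0)}|=N$, let $(\Gamma^{(k)})_{k\ge0}$ be the sequence of Lloyd iterates started at $\Gamma^{(0)}$, and let $(x^{(k)})_{k\ge0}$, $x^{(k)}=(x^{(k)}_1,\dots,x^{(k)}_N)$, be a consistent representation of it. Then all the iterates $\Gamma^{(k)}=\{x^{(k)}_i,\ i=1,\dots,N\}$ have full size $N$ and are contained in $\mathbf U$. Moreover: (a) If the sequence $(\Gamma^{(k)})_{k\ge 1}$ is bounded (or equivalently its consistent representations $(x^{(k)})_{k\ge0}$ are bounded), then $$\liminf_{k}\ \min_{1\le i,j\le N,\ i\ne j}\big|x^{(k)}_i-x^{(k)}_j\big|>0,$$ and there exist $\ell_\infty\in[0,e(\Gamma^{(0)},X))$ and a connected component $\mathcal C_{\ell_\infty,\mathbf U}$ of $$\Lambda_\infty:=\Big\{x\in\mathbf U^N:\ e(\{x_i,\ i=1,\dots,N\},X)=\ell_\infty,\ \nabla\mathcal G(x)=0\Big\}$$ such that $$\operatorname{dist}\big(x^{(k)},\mathcal C_{\ell_\infty,\mathbf U}\big)\to 0\quad\text{as }k\to+\infty .$$ In particular, if $\Lambda_\infty$ is locally finite (i.e. is reduced to finitely many points on each compact set), then $\Gamma^{(k)}\to\Gamma^{(\infty)}\in\Lambda_\infty$,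 i.e. $x^{(k)}$ converges in $(\mathbb R^d)^N$ to some $x^{(\infty)}\in\Lambda_\infty$ and $\Gamma^{(\infty)}=\{x^{(\infty)}_1,\dots,x^{(\infty)}_N\}$. (b) (Splitting method) If furthermore $e(\Gamma^{(0)},X)\in(e_N(X),e_{N-1}(X)]$, then the sequence $(\Gamma^{(k)})_{k\ge1}$ is always bounded and $\ell_\infty\in[e_N(X),e_{N-1}(X))$.
   Context: $|\cdot|$ is the canonical Euclidean norm on $\mathbb R^d$; $|A|$ also denotes the cardinality of a finite set $A$. Voronoi partition: for a finite set (grid) $\Gamma=\{x_1,\dots,x_N\}\subset\mathbf U$, a Voronoi partition $(C_i(\Gamma))_{1\le i\le N}$ is a Borel partition of $\mathbf U$ with $C_i(\Gamma)\subset\{\xi\in\mathbf U: |\xi-x_i|\le\min_{1\le j\le N}|\xi-x_j|\}$. Since $\mu$ charges no hyperplane, different choices differ only by $\mu$-null sets. Quantization error: $e(\Gamma,X)=\big(\mathbb E\min_{a\in\Gamma}|X-a|^2\big)^{1/2}$. Minimal error at level $n\ge1$: $e_n(X)=\inf\{e(\Gamma,X):\Gamma\subset\mathbb R^d,\ 1\le|\Gamma|\le n\}$. Distortion function: $\mathcal G(x)=\mathbb E\big(\min_{1\le i\le N}|X-x_i|^2\big)$ for $x=(x_1,\dots,x_N)\in(\mathbb R^d)^N$. When $\mu$ charges no hyperplane, it is differentiable at every $x$ with pairwise distinct components, with $\frac{\partial\mathcal G}{\partial x_i}(x)=2\,\mathbb E\big(\mathbf 1_{\{X\in C_i(x)\}}(x_i-X)\big)$,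 where $C_i(x)=C_i(\{x_1,\dots,x_N\})$; the condition $\nabla\mathcal G(x)=0$ is understood for such $x$. Lloyd iterates and consistent representation: number $\Gamma^{(0)}=\{x^{(0)}_1,\dots,x^{(0)}_N\}$ and set recursively $\Gamma^{(k)}=\{x^{(k)}_1,\dots,x^{(k)}_N\}$ with $$x^{(k+1)}_i=\frac{\mathbb E\big(X\mathbf 1_{\{X\in C_i(\Gamma^{(k)})\}}\big)}{\mathbb P\big(X\in C_i(\Gamma^{(k)})\big)}\ \text{ if } \mathbb P\big(X\in C_i(\Gamma^{(k)})\big)>0,\qquad x_i^{(k+1)}=x_i^{(k)}\ \text{ otherwise},$$ where $C_i(\Gamma^{(k)})$ is the cell of the point $x_i^{(k)}$. The sequence of $N$-tuples $(x^{(k)})_{k\ge0}$ is called a consistent representation of $(\Gamma^{(k)})_{k\ge 0}$ (there are $N!$ of them, one for each numbering of $\Gamma^{(0)}$). The sequence $(\Gamma^{(k)})$ is bounded if all $\Gamma^{(k)}$ lie in a common compact set.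
   Formalization: If ∇G(x^(0))=0 the iterates are constant and ℓ∞=e(Γ^(0),X), so strict bounds can fail. Proved: ℓ∞≤e(Γ^(0),X), strict if ∇G(x^(0))≠0; in (b) ℓ∞≤e_{N-1}(X), strict if ∇G(x^(0))≠0 or e(Γ^(0),X)<e_{N-1}(X). *)

theory Defs
  imports "HOL-Probability.Probability"
begin

definition msupport :: "'a::topological_space measure \<Rightarrow> 'a set" where
  "msupport \<mu> = {x. \<forall>S. open S \<longrightarrow> x \<in> S \<longrightarrow> emeasure \<mu> S > 0}"

definition charges_no_hyperplane :: "'a::euclidean_space measure \<Rightarrow> bool" where
  "charges_no_hyperplane \<mu> \<longleftrightarrow> (\<forall>a b. a \<noteq> 0 \<longrightarrow> {y. a \<bullet> y = b} \<in> null_sets \<mu>)"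

(* The cells are indexed by the points of the grid G: C a is the cell of a. *)
definition voronoi_partition ::
  "'a::euclidean_space set \<Rightarrow> 'a set \<Rightarrow> ('a \<Rightarrow> 'a set) \<Rightarrow> bool" where
  "voronoi_partition U G C \<longleftrightarrow>
     (\<forall>a\<in>G. C a \<in> sets borel \<and> C a \<subseteq> {y \<in> U. norm (y - a) \<le> Min ((\<lambda>b. norm (y - b)) ` G)}) \<and>
     disjoint_family_on C G \<and> (\<Union>a\<in>G. C a) = U"

(* A choice of a Voronoi partition for every grid: C G a is the cell of a in the
   partition attached to G. *)
definition voronoi_selection ::
  "'a::euclidean_space set \<Rightarrow> ('a set \<Rightarrow> 'a \<Rightarrow> 'a set) \<Rightarrow> bool" where
  "voronoi_selection U C \<longleftrightarrow>
     (\<forall>G. finite G \<longrightarrow> G \<noteq> {} \<longrightarrow> G \<subseteq> U \<longrightarrow> voronoi_partition U G (C G))"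

definition quant_error :: "'w measure \<Rightarrow> ('w \<Rightarrow> 'a::euclidean_space) \<Rightarrow> 'a set \<Rightarrow> real" where
  "quant_error M X G = sqrt (\<integral>\<omega>. Min ((\<lambda>a. (norm (X \<omega> - a))\<^sup>2) ` G) \<partial>M)"

definition min_quant_error :: "'w measure \<Rightarrow> ('w \<Rightarrow> 'a::euclidean_space) \<Rightarrow> nat \<Rightarrow> real" where
  "min_quant_error M X n =
     Inf {quant_error M X G | G. finite G \<and> 1 \<le> card G \<and> card G \<le> n}"

(* An N-tuple of points of R^d is a vector over an index type 'n with CARD('n) = N;
   its underlying grid is the range of its component function. *)
definition distortion ::
  "'w measure \<Rightarrow> ('w \<Rightarrow> 'a::euclidean_space) \<Rightarrow> 'a ^ 'n::finite \<Rightarrow> real" where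
  "distortion M X x = (\<integral>\<omega>. Min (range (\<lambda>i. (norm (X \<omega> - x $ i))\<^sup>2)) \<partial>M)"

(* "The gradient of the distortion vanishes at x"; this condition is only meaningful
   for tuples with pairwise distinct components, where the distortion is differentiable. *)
definition distortion_critical ::
  "'w measure \<Rightarrow> ('w \<Rightarrow> 'a::euclidean_space) \<Rightarrow> 'a ^ 'n::finite \<Rightarrow> bool" where
  "distortion_critical M X x \<longleftrightarrow> inj (\<lambda>i. x $ i) \<and> (GDERIV (distortion M X) x :> 0)"

definition lloyd_step ::
  "'w measure \<Rightarrow> ('w \<Rightarrow> 'a::euclidean_space) \<Rightarrow> ('a set \<Rightarrow> 'a \<Rightarrow> 'a set) \<Rightarrow> 'a set \<Rightarrow> 'a \<Rightarrow> 'a" where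
  "lloyd_step M X C G a =
     (let p = measure M {\<omega> \<in> space M. X \<omega> \<in> C G a}
      in if p > 0 then (\<integral>\<omega>. indicator (C G a) (X \<omega>) *\<^sub>R X \<omega> \<partial>M) /\<^sub>R p else a)"

primrec lloyd_iterate ::
  "'w measure \<Rightarrow> ('w \<Rightarrow> 'a::euclidean_space) \<Rightarrow> ('a set \<Rightarrow> 'a \<Rightarrow> 'a set) \<Rightarrow> 'a set \<Rightarrow> nat \<Rightarrow> 'a set" where
  "lloyd_iterate M X C G0 0 = G0"
| "lloyd_iterate M X C G0 (Suc k) =
     lloyd_step M X C (lloyd_iterate M X C G0 k) ` lloyd_iterate M X C G0 k"

definition consistent_representation ::
  "'w measure \<Rightarrow> ('w \<Rightarrow> 'a::euclidean_space) \<Rightarrow> ('a set \<Rightarrow> 'a \<Rightarrow> 'a set) \<Rightarrow> 'a set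
     \<Rightarrow> (nat \<Rightarrow> 'a ^ 'n::finite) \<Rightarrow> bool" where
  "consistent_representation M X C G0 x \<longleftrightarrow>
     range (\<lambda>i. x 0 $ i) = G0 \<and>
     (\<forall>k i. x (Suc k) $ i = lloyd_step M X C (range (\<lambda>j. x k $ j)) (x k $ i))"

definition critical_level_set ::
  "'w measure \<Rightarrow> ('w \<Rightarrow> 'a::euclidean_space) \<Rightarrow> 'a set \<Rightarrow> real \<Rightarrow> ('a ^ 'n::finite) set" where
  "critical_level_set M X U l =
     {x. (\<forall>i. x $ i \<in> U) \<and> quant_error M X (range (\<lambda>i. x $ i)) = l \<and> distortion_critical M X x}"

definition locally_finite_set :: "'a::topological_space set \<Rightarrow> bool" where
  "locally_finite_set S \<longleftrightarrow> (\<forall>K. compact K \<longrightarrow> finite (S \<inter> K))"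

definition bounded_grids :: "(nat \<Rightarrow> 'a::euclidean_space set) \<Rightarrow> bool" where
  "bounded_grids G \<longleftrightarrow> (\<exists>K. compact K \<and> (\<forall>k\<ge>1. G k \<subseteq> K))"

end

theory Submission
  imports Defs
begin

text \<open>
Everything depends on \<open>X\<close> only through its law \<open>\<mu>\<close>, and on the choice of the Voronoi cells only up to
\<open>\<mu>\<close>-null sets: bisectors of distinct points are hyperplanes, so for a tuple \<open>x\<close> with distinct
components the open cells cover almost everything. Write \<open>energy\<close> for the squared quantization error.

One inequality carries most of the analysis (\<open>energy_le_quadratic\<close>). Attach every \<open>\<xi>\<close> in the cell of
\<open>x\<^sub>i\<close> to the possibly suboptimal point \<open>z\<^sub>i\<close> and expand the square: this bounds \<open>energy z\<close> by \<open>energy x\<close>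
plus a quadratic polynomial in \<open>z - x\<close> whose linear part is twice the \<open>defect\<close> of \<open>x\<close>. Minimising the
polynomial gives Lloyd's map and its descent by at least \<open>\<Sum>\<^sub>i mass\<^sub>i \<bar>z\<^sub>i - x\<^sub>i\<bar>\<^sup>2\<close> (\<open>energy_lloyd_le\<close>). Using the
inequality once from \<open>x\<close> to \<open>y\<close> and once from \<open>y\<close> to \<open>x\<close>, together with the continuity of the defect,
gives the gradient (\<open>GDERIV_energy\<close>), so that a fixed point of Lloyd's map is critical. The centroid of
an open cell lies in that cell, and in the convex support, hence distinctness and containment in the
support propagate along the iteration.

The heart of the bounded case is that points cannot merge in the limit (\<open>limit_point_distinct\<close>). Suppose
\<open>x\<^sub>i\<close> and \<open>x\<^sub>j\<close> both tend to \<open>b\<close> along a subsequence, in such a way that the direction of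
\<open>x\<^sub>i - x\<^sub>j\<close> tends to \<open>u\<close>. The cell of \<open>x\<^sub>i\<close> is on one side of the bisector, which tends to the
hyperplane through \<open>b\<close> orthogonal to \<open>u\<close>. By descent, \<open>mass\<^sub>i\<close> times the step of \<open>x\<^sub>i\<close> tends to \<open>0\<close>, so
the first moment of the cell relative to this hyperplane tends to \<open>0\<close>. As all of it has one sign and
the limit hyperplane has measure \<open>0\<close>, the mass of the cell tends to \<open>0\<close>
(\<open>colliding_point_loses_mass\<close>). But the cells of all points merging at \<open>b\<close> jointly contain almost all
of a fixed ball around \<open>b\<close>, which has positive mass because \<open>b\<close> is in the support.

Consequently the points of a bounded sequence stay a fixed distance apart, their cells have mass
bounded below, and the steps tend to \<open>0\<close>. The limit set of such a sequence is nonempty, compact and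
connected; by continuity its elements are fixed points of Lloyd's map at the limiting energy, hence they
are critical. So the limit set lies in one component of the critical level set, and the
sequence approaches that component.

For the splitting method: an energy bound keeps at least one point in a fixed ball. A very distant
point then serves only the tail of \<open>\<mu>\<close>, and removing it costs little energy
(\<open>energy_remove_far_point\<close>). If the energy is below the optimum for one point fewer by a fixed
margin, no point can be that distant. This margin is present from the first step on, unless the first
step does not move, in which case the sequence is constant.
\<close>

section \<open>Squared distance to a grid and open Voronoi cells\<close>

abbreviation grid :: "'a ^ 'n \<Rightarrow> 'a set" where
  "grid x \<equiv> range (\<lambda>i. x $ i)"

definition sq_dist :: "'a::real_normed_vector set \<Rightarrow> 'a \<Rightarrow> real" where
  "sq_dist A \<xi> = Min ((\<lambda>a. (norm (\<xi> - a))\<^sup>2) ` A)"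

text \<open>Strict inequalities make the cells open and disjoint even when components of \<open>x\<close> coincide; indexing
by \<open>'n\<close> instead of by points lets the cells vary with the tuple.\<close>

definition open_cell :: "'a::real_normed_vector ^ 'n \<Rightarrow> 'n \<Rightarrow> 'a set" where
  "open_cell x i = {\<xi>. \<forall>j. j \<noteq> i \<longrightarrow> norm (\<xi> - x $ i) < norm (\<xi> - x $ j)}"

lemma sq_dist_nonneg: "finite A \<Longrightarrow> A \<noteq> {} \<Longrightarrow> 0 \<le> sq_dist A \<xi>"
  unfolding sq_dist_def by (subst Min_ge_iff) auto

lemma sq_dist_le: "finite A \<Longrightarrow> a \<in> A \<Longrightarrow> sq_dist A \<xi> \<le> (norm (\<xi> - a))\<^sup>2"
  unfolding sq_dist_def by (rule Min_le) auto

lemma sq_dist_attained: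
  assumes "finite A" "A \<noteq> {}"
  obtains a where "a \<in> A" "sq_dist A \<xi> = (norm (\<xi> - a))\<^sup>2"
proof -
  have "Min ((\<lambda>a. (norm (\<xi> - a))\<^sup>2) ` A) \<in> (\<lambda>a. (norm (\<xi> - a))\<^sup>2) ` A"
    using assms by (intro Min_in) auto
  then show ?thesis using that unfolding sq_dist_def by auto
qed

lemma open_cell_disjoint: "\<xi> \<in> open_cell x i \<Longrightarrow> \<xi> \<in> open_cell x j \<Longrightarrow> i = j"
  unfolding open_cell_def by (metis (mono_tags, lifting) mem_Collect_eq order_less_asym)

lemma sq_dist_open_cell:
  fixes x :: "'a::real_normed_vector ^ 'n::finite"
  assumes "\<xi> \<in> open_cell x i"
  shows "sq_dist (grid x) \<xi> = (norm (\<xi> - x $ i))\<^sup>2"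
proof (rule antisym)
  show "sq_dist (grid x) \<xi> \<le> (norm (\<xi> - x $ i))\<^sup>2" by (rule sq_dist_le) auto
  obtain j where j: "sq_dist (grid x) \<xi> = (norm (\<xi> - x $ j))\<^sup>2"
    by (rule sq_dist_attained[of "grid x" \<xi>]) auto
  have "norm (\<xi> - x $ i) \<le> norm (\<xi> - x $ j)"
    using assms unfolding open_cell_def by (cases "j = i") (auto intro: less_imp_le)
  then show "(norm (\<xi> - x $ i))\<^sup>2 \<le> sq_dist (grid x) \<xi>"
    by (simp add: j power_mono)
qed

lemma open_open_cell:
  fixes x :: "'a::real_normed_vector ^ 'n::finite"
  shows "open (open_cell x i)"
proof -
  have "open_cell x i = (\<Inter>j\<in>-{i}. {\<xi>. norm (\<xi> - x $ i) < norm (\<xi> - x $ j)})"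
    unfolding open_cell_def by auto
  moreover have "open (\<Inter>j\<in>-{i}. {\<xi>. norm (\<xi> - x $ i) < norm (\<xi> - x $ j)})"
    by (intro open_INT finite ballI open_Collect_less continuous_intros)
  ultimately show ?thesis by simp
qed

lemma open_cell_borel [measurable]: "open_cell (x :: 'a::real_normed_vector ^ 'n::finite) i \<in> sets borel"
  by (simp add: open_open_cell)

lemma open_cell_exists:
  fixes x :: "'a::real_normed_vector ^ 'n::finite"
  assumes "\<And>i j. i \<noteq> j \<Longrightarrow> norm (\<xi> - x $ i) \<noteq> norm (\<xi> - x $ j)"
  shows "\<exists>i. \<xi> \<in> open_cell x i"
proof -
  obtain i where i: "sq_dist (grid x) \<xi> = (norm (\<xi> - x $ i))\<^sup>2"
    by (rule sq_dist_attained[of "grid x" \<xi>]) auto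
  have "norm (\<xi> - x $ i) < norm (\<xi> - x $ j)" if "j \<noteq> i" for j
  proof -
    have "(norm (\<xi> - x $ i))\<^sup>2 \<le> (norm (\<xi> - x $ j))\<^sup>2"
      using sq_dist_le[of "grid x" "x $ j" \<xi>] i by simp
    then show ?thesis using assms[OF that] by (simp add: power2_le_iff_abs_le)
  qed
  then show ?thesis unfolding open_cell_def by auto
qed

text \<open>Membership in a cell is locally constant in the tuple away from the bisectors; integrals over cells
are therefore continuous functions of the tuple, by dominated convergence.\<close>

lemma eventually_mem_open_cell_iff:
  fixes z :: "'b \<Rightarrow> 'a::real_normed_vector ^ 'n::finite"
  assumes "(z \<longlongrightarrow> y) F" "\<xi> \<in> open_cell y j"
  shows "eventually (\<lambda>t. \<xi> \<in> open_cell (z t) i \<longleftrightarrow> i = j) F"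
proof -
  have "eventually (\<lambda>t. norm (\<xi> - z t $ j) < norm (\<xi> - z t $ k)) F" if "k \<noteq> j" for k
  proof -
    have "((\<lambda>t. norm (\<xi> - z t $ k) - norm (\<xi> - z t $ j)) \<longlongrightarrow> norm (\<xi> - y $ k) - norm (\<xi> - y $ j)) F"
      by (intro tendsto_intros assms(1))
    moreover have "0 < norm (\<xi> - y $ k) - norm (\<xi> - y $ j)"
      using assms(2) that unfolding open_cell_def by auto
    ultimately have "eventually (\<lambda>t. 0 < norm (\<xi> - z t $ k) - norm (\<xi> - z t $ j)) F"
      by (rule order_tendstoD(1))
    then show ?thesis by (rule eventually_mono) simp
  qed
  then have "eventually (\<lambda>t. k \<noteq> j \<longrightarrow> norm (\<xi> - z t $ j) < norm (\<xi> - z t $ k)) F" for k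
    by (cases "k = j") simp_all
  then have "eventually (\<lambda>t. \<forall>k. k \<noteq> j \<longrightarrow> norm (\<xi> - z t $ j) < norm (\<xi> - z t $ k)) F"
    by (rule eventually_all_finite)
  then have "eventually (\<lambda>t. \<xi> \<in> open_cell (z t) j) F"
    by (simp add: open_cell_def)
  then show ?thesis
    by (rule eventually_mono) (auto dest: open_cell_disjoint)
qed

lemma eventually_distinct_components:
  fixes y :: "'a::t2_space ^ 'n::finite"
  assumes "inj (\<lambda>i. y $ i)"
  shows "eventually (\<lambda>x. inj (\<lambda>i. x $ i)) (nhds y)"
proof -
  have "eventually (\<lambda>x. x $ i \<noteq> x $ j) (nhds y)" if "i \<noteq> j" for i j
  proof -
    have "y $ i \<noteq> y $ j" using assms that by (auto dest: injD)
    then obtain S T where ST: "open S" "open T" "y $ i \<in> S" "y $ j \<in> T" "S \<inter> T = {}"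
      using hausdorff by metis
    have "eventually (\<lambda>x. x $ i \<in> S) (nhds y)" "eventually (\<lambda>x. x $ j \<in> T) (nhds y)"
      using ST topological_tendstoD[OF tendsto_vec_nth[OF filterlim_ident]] by blast+
    then show ?thesis by eventually_elim (use ST in auto)
  qed
  then have "eventually (\<lambda>x. i \<noteq> j \<longrightarrow> x $ i \<noteq> x $ j) (nhds y)" for i j
    by (cases "i = j") simp_all
  then have "eventually (\<lambda>x. \<forall>i j. i \<noteq> j \<longrightarrow> x $ i \<noteq> x $ j) (nhds y)"
    by (intro eventually_all_finite)
  then show ?thesis by (rule eventually_mono) (auto simp: inj_def)
qed

lemma sq_dist_difference:
  fixes \<xi> a b :: "'a::real_inner"
  shows "(norm (\<xi> - b))\<^sup>2 - (norm (\<xi> - a))\<^sup>2 = (norm (b - a))\<^sup>2 + 2 * ((b - a) \<bullet> (a - \<xi>))"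
  by (simp add: power2_norm_eq_inner inner_diff_left inner_diff_right inner_commute algebra_simps)

section \<open>Energy of a grid under a law charging no hyperplane\<close>

locale hyperplane_free_law = prob_space \<mu> for \<mu> :: "'a::euclidean_space measure" +
  assumes sets_eq_borel [measurable_cong, simp]: "sets \<mu> = sets borel"
    and square_integrable: "integrable \<mu> (\<lambda>\<xi>. (norm \<xi>)\<^sup>2)"
    and no_hyperplane: "charges_no_hyperplane \<mu>"
begin

lemma space_eq_UNIV [simp]: "space \<mu> = UNIV"
  using sets_eq_imp_space_eq[OF sets_eq_borel] by simp

lemma integrable_ident [simp, intro]: "integrable \<mu> (\<lambda>\<xi>. \<xi>)"
proof -
  have "integrable \<mu> (\<lambda>\<xi>. norm \<xi>)"
    by (rule square_integrable_imp_integrable[OF _ square_integrable]) auto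
  then show ?thesis by (subst (asm) integrable_norm_iff) auto
qed

lemma integrable_sq_dist_point [simp, intro]: "integrable \<mu> (\<lambda>\<xi>. (norm (\<xi> - a))\<^sup>2)"
proof -
  have "integrable \<mu> (\<lambda>\<xi>. (norm \<xi>)\<^sup>2 - 2 * (\<xi> \<bullet> a) + (norm a)\<^sup>2)"
    using square_integrable by (intro Bochner_Integration.integrable_add Bochner_Integration.integrable_diff
      integrable_mult_right integrable_inner_left) auto
  also have "(\<lambda>\<xi>. (norm \<xi>)\<^sup>2 - 2 * (\<xi> \<bullet> a) + (norm a)\<^sup>2) = (\<lambda>\<xi>. (norm (\<xi> - a))\<^sup>2)"
    by (auto simp: power2_norm_eq_inner inner_diff_left inner_diff_right inner_commute)
  finally show ?thesis .
qed

lemma sq_dist_measurable [measurable]: "finite (A :: 'a set) \<Longrightarrow> sq_dist A \<in> borel_measurable borel"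
  unfolding sq_dist_def by measurable

lemma integrable_sq_dist:
  assumes "finite A" "A \<noteq> {}"
  shows "integrable \<mu> (sq_dist A)"
proof -
  obtain a where "a \<in> A" using assms by auto
  then show ?thesis
    using assms sq_dist_le[OF assms(1), of a] sq_dist_nonneg[OF assms]
    by (intro Bochner_Integration.integrable_bound[OF integrable_sq_dist_point[of a]]) auto
qed

definition energy :: "'a set \<Rightarrow> real" where
  "energy A = (\<integral>\<xi>. sq_dist A \<xi> \<partial>\<mu>)"

definition mass :: "'a ^ 'n::finite \<Rightarrow> 'n \<Rightarrow> real" where
  "mass x i = measure \<mu> (open_cell x i)"

definition moment :: "'a ^ 'n::finite \<Rightarrow> 'n \<Rightarrow> 'a" where
  "moment x i = (\<integral>\<xi>. indicator (open_cell x i) \<xi> *\<^sub>R \<xi> \<partial>\<mu>)"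

text \<open>At tuples with distinct components, half of the gradient of the energy with respect to \<open>x\<^sub>i\<close>.\<close>

definition defect :: "'a ^ 'n::finite \<Rightarrow> 'n \<Rightarrow> 'a" where
  "defect x i = mass x i *\<^sub>R x $ i - moment x i"

text \<open>Every point moves to the centroid of its cell. Where the mass is \<open>0\<close>, the moment is \<open>0\<close> as well and
the value is \<open>0\<close>; this map is applied only to tuples of distinct points of the support, where all
masses are positive.\<close>

definition lloyd :: "'a ^ 'n::finite \<Rightarrow> 'a ^ 'n" where
  "lloyd x = (\<chi> i. moment x i /\<^sub>R mass x i)"

lemma energy_nonneg: "finite A \<Longrightarrow> A \<noteq> {} \<Longrightarrow> 0 \<le> energy A"
  unfolding energy_def by (intro Bochner_Integration.integral_nonneg) (auto simp: sq_dist_nonneg)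

lemma mass_nonneg: "0 \<le> mass x i" and mass_le_1: "mass x i \<le> 1"
  unfolding mass_def by auto

lemma AE_off_hyperplane:
  assumes "a \<noteq> 0"
  shows "AE \<xi> in \<mu>. a \<bullet> \<xi> \<noteq> b"
  using no_hyperplane assms unfolding charges_no_hyperplane_def
  by (intro AE_I'[of "{y. a \<bullet> y = b}"]) auto

lemma AE_off_bisector:
  assumes "a \<noteq> b"
  shows "AE \<xi> in \<mu>. norm (\<xi> - a) \<noteq> norm (\<xi> - b)"
proof -
  have "AE \<xi> in \<mu>. (b - a) \<bullet> \<xi> \<noteq> (b - a) \<bullet> a + (norm (b - a))\<^sup>2 / 2"
    using assms by (intro AE_off_hyperplane) auto
  then show ?thesis
  proof (rule AE_mp, intro AE_I2 impI notI)
    fix \<xi> assume *: "(b - a) \<bullet> \<xi> \<noteq> (b - a) \<bullet> a + (norm (b - a))\<^sup>2 / 2" "norm (\<xi> - a) = norm (\<xi> - b)"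
    have "(norm (b - a))\<^sup>2 + 2 * ((b - a) \<bullet> (a - \<xi>)) = 0"
      using sq_dist_difference[of \<xi> b a] *(2) by simp
    with *(1) show False by (simp add: inner_diff_right)
  qed
qed

text \<open>A point outside all bisectors has a unique nearest component, and bisectors of distinct points are null
hyperplanes.\<close>

lemma AE_in_open_cell:
  fixes x :: "'a ^ 'n::finite"
  assumes "inj (\<lambda>i. x $ i)"
  shows "AE \<xi> in \<mu>. \<exists>i. \<xi> \<in> open_cell x i"
proof -
  have "AE \<xi> in \<mu>. \<forall>i\<in>UNIV. \<forall>j\<in>-{i}. norm (\<xi> - x $ i) \<noteq> norm (\<xi> - x $ j)"
    using assms by (intro AE_finite_allI AE_off_bisector) (auto dest: injD)
  then show ?thesis
    by (rule AE_mp) (intro AE_I2 impI open_cell_exists, auto)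
qed

lemma integrable_cell_moment [simp, intro]:
  "integrable \<mu> (\<lambda>\<xi>. indicator (open_cell (x :: 'a ^ 'n::finite) i) \<xi> *\<^sub>R \<xi>)"
  by (rule integrable_mult_indicator) auto

lemma integral_cell_affine:
  fixes x :: "'a ^ 'n::finite"
  shows "integrable \<mu> (\<lambda>\<xi>. indicator (open_cell x i) \<xi> * (c + v \<bullet> \<xi>))" (is ?int)
    and "(\<integral>\<xi>. indicator (open_cell x i) \<xi> * (c + v \<bullet> \<xi>) \<partial>\<mu>) = c * mass x i + v \<bullet> moment x i" (is ?eq)
proof -
  have eq: "(\<lambda>\<xi>. indicator (open_cell x i) \<xi> * (c + v \<bullet> \<xi>)) =
      (\<lambda>\<xi>. c * indicator (open_cell x i) \<xi> + v \<bullet> (indicator (open_cell x i) \<xi> *\<^sub>R \<xi>))"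
    by (auto simp: algebra_simps)
  have i1: "integrable \<mu> (\<lambda>\<xi>. c * indicator (open_cell x i) \<xi>)"
    by (intro integrable_mult_right integrable_real_indicator) (auto simp: emeasure_eq_measure)
  have i2: "integrable \<mu> (\<lambda>\<xi>. v \<bullet> (indicator (open_cell x i) \<xi> *\<^sub>R \<xi>))"
    by (intro integrable_inner_right) auto
  show ?int unfolding eq using i1 i2 by (rule Bochner_Integration.integrable_add)
  show ?eq unfolding eq Bochner_Integration.integral_add[OF i1 i2]
    by (subst integral_inner_right) (auto simp: mass_def moment_def)
qed

text \<open>The squared distance to the grid of \<open>z\<close> is at most the squared distance to \<open>z\<^sub>i\<close>, and on the cell of
\<open>x\<^sub>i\<close> the squared distance to the grid of \<open>x\<close> is the one to \<open>x\<^sub>i\<close>. The difference of the two squares is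
affine in \<open>\<xi>\<close>, so its integral over the cell involves only mass and moment.\<close>

lemma energy_le_quadratic:
  fixes x z :: "'a ^ 'n::finite"
  assumes "inj (\<lambda>i. x $ i)"
  shows "energy (grid z) \<le> energy (grid x)
     + (\<Sum>i\<in>UNIV. mass x i * (norm (z $ i - x $ i))\<^sup>2 + 2 * ((z $ i - x $ i) \<bullet> defect x i))"
proof -
  define q where "q i \<xi> = indicator (open_cell x i) \<xi> *
     (((norm (z $ i - x $ i))\<^sup>2 + 2 * ((z $ i - x $ i) \<bullet> x $ i)) + (- 2 *\<^sub>R (z $ i - x $ i)) \<bullet> \<xi>)" for i \<xi>
  have q_int: "integrable \<mu> (q i)" for i
    unfolding q_def by (rule integral_cell_affine)
  have q_val: "(\<integral>\<xi>. q i \<xi> \<partial>\<mu>) = mass x i * (norm (z $ i - x $ i))\<^sup>2 + 2 * ((z $ i - x $ i) \<bullet> defect x i)" for i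
    unfolding q_def integral_cell_affine defect_def
    by (simp add: inner_diff_left inner_diff_right algebra_simps)
  have "AE \<xi> in \<mu>. sq_dist (grid z) \<xi> \<le> sq_dist (grid x) \<xi> + (\<Sum>i\<in>UNIV. q i \<xi>)"
    using AE_in_open_cell[OF assms]
  proof (rule AE_mp, intro AE_I2 impI)
    fix \<xi> assume "\<exists>i. \<xi> \<in> open_cell x i"
    then obtain i where i: "\<xi> \<in> open_cell x i" by blast
    have "(\<Sum>j\<in>UNIV. q j \<xi>) = (\<Sum>j\<in>UNIV. if j = i then q i \<xi> else 0)"
      using open_cell_disjoint[OF i] by (intro sum.cong) (auto simp: q_def indicator_def)
    also have "\<dots> = q i \<xi>" by simp
    also have "\<dots> = (norm (\<xi> - z $ i))\<^sup>2 - (norm (\<xi> - x $ i))\<^sup>2"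
      unfolding q_def sq_dist_difference using i by (simp add: inner_diff_right)
    finally show "sq_dist (grid z) \<xi> \<le> sq_dist (grid x) \<xi> + (\<Sum>i\<in>UNIV. q i \<xi>)"
      using sq_dist_le[of "grid z" "z $ i" \<xi>] by (simp add: sq_dist_open_cell[OF i])
  qed
  then have "energy (grid z) \<le> (\<integral>\<xi>. sq_dist (grid x) \<xi> + (\<Sum>i\<in>UNIV. q i \<xi>) \<partial>\<mu>)"
    unfolding energy_def
    by (intro integral_mono_AE integrable_sq_dist Bochner_Integration.integrable_add
        Bochner_Integration.integrable_sum q_int) auto
  also have "\<dots> = energy (grid x) + (\<Sum>i\<in>UNIV. \<integral>\<xi>. q i \<xi> \<partial>\<mu>)"
    unfolding energy_def
    by (simp add: integrable_sq_dist q_int)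
  finally show ?thesis unfolding q_val .
qed

end

section \<open>Gradient of the energy\<close>

context hyperplane_free_law
begin

lemma isCont_cell_integral:
  fixes g :: "'a \<Rightarrow> 'b::{banach, second_countable_topology}" and y :: "'a ^ 'n::finite"
  assumes "integrable \<mu> g" "inj (\<lambda>i. y $ i)"
  shows "isCont (\<lambda>x. \<integral>\<xi>. indicator (open_cell x i) \<xi> *\<^sub>R g \<xi> \<partial>\<mu>) y"
  unfolding continuous_at_sequentially comp_def
proof (intro allI impI)
  fix z :: "nat \<Rightarrow> 'a ^ 'n" assume z: "z \<longlonglongrightarrow> y"
  have [measurable]: "g \<in> borel_measurable borel"
    using assms(1) by (auto dest: borel_measurable_integrable)
  show "(\<lambda>t. \<integral>\<xi>. indicator (open_cell (z t) i) \<xi> *\<^sub>R g \<xi> \<partial>\<mu>) \<longlonglongrightarrow> (\<integral>\<xi>. indicator (open_cell y i) \<xi> *\<^sub>R g \<xi> \<partial>\<mu>)"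
  proof (rule integral_dominated_convergence[where w = "\<lambda>\<xi>. norm (g \<xi>)"])
    show "AE \<xi> in \<mu>. (\<lambda>t. indicator (open_cell (z t) i) \<xi> *\<^sub>R g \<xi>) \<longlonglongrightarrow> indicator (open_cell y i) \<xi> *\<^sub>R g \<xi>"
      using AE_in_open_cell[OF assms(2)]
    proof (rule AE_mp, intro AE_I2 impI)
      fix \<xi> assume "\<exists>j. \<xi> \<in> open_cell y j"
      then obtain j where j: "\<xi> \<in> open_cell y j" by blast
      have "eventually (\<lambda>t. indicator (open_cell (z t) i) \<xi> *\<^sub>R g \<xi> = indicator (open_cell y i) \<xi> *\<^sub>R g \<xi>) sequentially"
        using eventually_mem_open_cell_iff[OF z j, of i]
      proof (rule eventually_mono)
        fix t assume "\<xi> \<in> open_cell (z t) i \<longleftrightarrow> i = j"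
        moreover have "\<xi> \<in> open_cell y i \<longleftrightarrow> i = j"
          using j open_cell_disjoint[OF j] by metis
        ultimately show "indicator (open_cell (z t) i) \<xi> *\<^sub>R g \<xi> = indicator (open_cell y i) \<xi> *\<^sub>R g \<xi>"
          by (simp add: indicator_def)
      qed
      then show "(\<lambda>t. indicator (open_cell (z t) i) \<xi> *\<^sub>R g \<xi>) \<longlonglongrightarrow> indicator (open_cell y i) \<xi> *\<^sub>R g \<xi>"
        by (rule tendsto_eventually)
    qed
  qed (auto simp: assms(1) indicator_def)
qed

lemma isCont_mass: "inj (\<lambda>i. y $ i) \<Longrightarrow> isCont (\<lambda>x. mass x i) (y :: 'a ^ 'n::finite)"
  using isCont_cell_integral[where g = "\<lambda>_. 1::real" and y = y and i = i] by (simp add: mass_def)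

lemma isCont_moment: "inj (\<lambda>i. y $ i) \<Longrightarrow> isCont (\<lambda>x. moment x i) (y :: 'a ^ 'n::finite)"
  using isCont_cell_integral[where g = "\<lambda>\<xi>. \<xi>" and y = y and i = i] by (simp add: moment_def)

lemma isCont_defect: "inj (\<lambda>i. y $ i) \<Longrightarrow> isCont (\<lambda>x. defect x i) (y :: 'a ^ 'n::finite)"
  unfolding defect_def by (intro continuous_intros isCont_mass isCont_moment)

text \<open>The quadratic bound based at \<open>y\<close> controls \<open>energy x - energy y\<close> from above, and the bound based at \<open>x\<close>
controls it from below, with the defect at \<open>x\<close> in place of the one at \<open>y\<close>. The two defects differ by
\<open>o(1)\<close>, so no differentiation under the integral over moving cells is needed.\<close>

theorem GDERIV_energy:
  fixes y :: "'a ^ 'n::finite"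
  assumes "inj (\<lambda>i. y $ i)"
  shows "GDERIV (\<lambda>x. energy (grid x)) y :> (\<chi> i. 2 *\<^sub>R defect y i)"
  unfolding gderiv_def has_derivative_iff_norm
proof (intro conjI)
  let ?g = "(\<chi> i. 2 *\<^sub>R defect y i) :: 'a ^ 'n"
  show "bounded_linear (\<lambda>h. h \<bullet> ?g)" by (rule bounded_linear_inner_left)
  define b where "b x = (\<Sum>i\<in>UNIV. norm (x $ i - y $ i) + 2 * norm (defect x i - defect y i))" for x :: "'a ^ 'n"
  have inner_g: "h \<bullet> ?g = (\<Sum>i\<in>UNIV. 2 * (h $ i \<bullet> defect y i))" for h
    by (simp add: inner_vec_def)
  have bound: "norm (energy (grid x) - energy (grid y) - (x - y) \<bullet> ?g) / norm (x - y) \<le> b x"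
    if inj: "inj (\<lambda>i. x $ i)" and "x \<noteq> y" for x :: "'a ^ 'n"
  proof -
    let ?d = "\<lambda>i. x $ i - y $ i"
    have termwise: "mass w i * (norm (?d i))\<^sup>2 + 2 * (?d i \<bullet> v) \<le> norm (x - y) * (norm (?d i) + 2 * norm v)"
      for w :: "'a ^ 'n" and i v
    proof -
      have d: "norm (?d i) \<le> norm (x - y)"
        using Finite_Cartesian_Product.norm_nth_le[of "x - y" i] by simp
      have "mass w i * (norm (?d i))\<^sup>2 \<le> 1 * (norm (?d i) * norm (?d i))"
        unfolding power2_eq_square by (intro mult_right_mono mass_le_1) auto
      also have "\<dots> \<le> norm (x - y) * norm (?d i)" using d by (simp add: mult_right_mono)
      finally have 1: "mass w i * (norm (?d i))\<^sup>2 \<le> norm (x - y) * norm (?d i)" .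
      have "?d i \<bullet> v \<le> norm (?d i) * norm v" by (rule norm_cauchy_schwarz)
      also have "\<dots> \<le> norm (x - y) * norm v" using d by (simp add: mult_right_mono)
      finally show ?thesis using 1 by (simp add: algebra_simps)
    qed
    have "energy (grid x) - energy (grid y) - (x - y) \<bullet> ?g
        \<le> (\<Sum>i\<in>UNIV. mass y i * (norm (?d i))\<^sup>2 + 2 * (?d i \<bullet> 0))"
      using energy_le_quadratic[OF assms, of x] unfolding inner_g by (simp add: sum.distrib)
    also have "\<dots> \<le> (\<Sum>i\<in>UNIV. norm (x - y) * (norm (?d i) + 2 * norm (0::'a)))"
      by (intro sum_mono termwise)
    also have "\<dots> \<le> norm (x - y) * b x"
      unfolding b_def sum_distrib_left by (intro sum_mono mult_left_mono) auto
    finally have up: "energy (grid x) - energy (grid y) - (x - y) \<bullet> ?g \<le> norm (x - y) * b x" .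
    have "- (energy (grid x) - energy (grid y) - (x - y) \<bullet> ?g)
        \<le> (\<Sum>i\<in>UNIV. mass x i * (norm (?d i))\<^sup>2 + 2 * (- ?d i \<bullet> defect x i)) + (x - y) \<bullet> ?g"
      using energy_le_quadratic[OF inj, of y] by (simp add: norm_minus_commute)
    also have "\<dots> = (\<Sum>i\<in>UNIV. mass x i * (norm (?d i))\<^sup>2 + 2 * (?d i \<bullet> (defect y i - defect x i)))"
      unfolding inner_g sum.distrib[symmetric]
      by (intro sum.cong) (auto simp: inner_diff_right inner_diff_left algebra_simps)
    also have "\<dots> \<le> (\<Sum>i\<in>UNIV. norm (x - y) * (norm (?d i) + 2 * norm (defect y i - defect x i)))"
      by (intro sum_mono termwise)
    also have "\<dots> = norm (x - y) * b x"
      unfolding b_def sum_distrib_left by (simp add: norm_minus_commute)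
    finally have "\<bar>energy (grid x) - energy (grid y) - (x - y) \<bullet> ?g\<bar> \<le> norm (x - y) * b x"
      using up by linarith
    then show ?thesis using \<open>x \<noteq> y\<close> by (simp add: divide_le_eq mult.commute)
  qed
  have "(b \<longlongrightarrow> (\<Sum>i\<in>UNIV. norm (y $ i - y $ i) + 2 * norm (defect y i - defect y i))) (at y)"
    unfolding b_def using isCont_defect[OF assms, unfolded isCont_def]
    by (intro tendsto_intros) auto
  then have b0: "(b \<longlongrightarrow> 0) (at y)" by simp
  show "((\<lambda>x. norm (energy (grid x) - energy (grid y) - (x - y) \<bullet> ?g) / norm (x - y)) \<longlongrightarrow> 0) (at y)"
  proof (rule tendsto_sandwich[OF _ _ tendsto_const b0])
    have "eventually (\<lambda>x. inj (\<lambda>i. x $ i) \<and> x \<noteq> y) (at y)"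
      using eventually_distinct_components[OF assms]
      unfolding eventually_at_filter by (rule eventually_mono) simp
    then show "eventually (\<lambda>x. norm (energy (grid x) - energy (grid y) - (x - y) \<bullet> ?g) / norm (x - y) \<le> b x) (at y)"
      by (rule eventually_mono) (use bound in auto)
  qed auto
qed

end

section \<open>Support of the law and the Lloyd map\<close>

lemma closed_msupport: "closed (msupport \<mu>)"
proof -
  have "- msupport \<mu> = \<Union> {S. open S \<and> emeasure \<mu> S = 0}"
    unfolding msupport_def by auto
  then show ?thesis unfolding closed_def by auto
qed

text \<open>The complement of the support is a union of open null sets, and by the Lindelof property countably many
of them suffice.\<close>

lemma AE_in_msupport:
  fixes \<mu> :: "'a::second_countable_topology measure"
  assumes "sets \<mu> = sets borel"
  shows "AE \<xi> in \<mu>. \<xi> \<in> msupport \<mu>"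
proof -
  let ?F = "{S. open S \<and> emeasure \<mu> S = 0}"
  obtain F where F: "F \<subseteq> ?F" "countable F" "\<Union> F = \<Union> ?F"
    using Lindelof[of ?F] by auto
  have "\<Union> F \<in> null_sets \<mu>"
    using F by (intro null_sets_UN'[of F "\<lambda>S. S", simplified]) (auto simp: null_sets_def assms)
  moreover have "{\<xi>. \<xi> \<notin> msupport \<mu>} \<subseteq> \<Union> F"
    unfolding F(3) msupport_def by auto
  ultimately show ?thesis by (intro AE_I'[of "\<Union> F"]) auto
qed

lemma mem_open_cell_self: "inj (\<lambda>i. x $ i) \<Longrightarrow> x $ i \<in> open_cell x i"
  unfolding open_cell_def by (auto dest: injD)

lemma ball_subset_open_cell:
  assumes "\<And>j. j \<noteq> i \<Longrightarrow> \<delta> \<le> norm (x $ i - x $ j)"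
  shows "ball (x $ i) (\<delta> / 2) \<subseteq> open_cell x i"
proof
  fix \<xi> assume \<xi>: "\<xi> \<in> ball (x $ i) (\<delta> / 2)"
  have "norm (\<xi> - x $ i) < norm (\<xi> - x $ j)" if "j \<noteq> i" for j
    using \<xi> assms[OF that] norm_triangle_ineq4[of "\<xi> - x $ j" "\<xi> - x $ i"]
    by (simp add: dist_norm norm_minus_commute)
  then show "\<xi> \<in> open_cell x i" unfolding open_cell_def by blast
qed

context hyperplane_free_law
begin

lemma measure_pos_if_meets_msupport:
  assumes "open S" "a \<in> S" "a \<in> msupport \<mu>"
  shows "0 < measure \<mu> S"
  using assms unfolding msupport_def by (auto simp: emeasure_eq_measure)

text \<open>A compact set is covered by finitely many balls of half the radius centred in the support, and each
ball of the full radius contains one of them.\<close>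

lemma ball_measure_bounded_below:
  assumes "bounded A" "A \<subseteq> msupport \<mu>" "r > 0"
  obtains c where "c > 0" "\<And>a. a \<in> A \<Longrightarrow> c \<le> measure \<mu> (ball a r)"
proof -
  have "compact (closure A)" using assms(1) by (simp add: compact_closure)
  then obtain F where F: "F \<subseteq> closure A" "finite F" "closure A \<subseteq> (\<Union>b\<in>F. ball b (r / 2))"
  proof (rule compactE_image[of "closure A" "closure A" "\<lambda>b. ball b (r / 2)"])
    show "closure A \<subseteq> (\<Union>b\<in>closure A. ball b (r / 2))" using assms(3) by auto
  qed auto
  have supp: "F \<subseteq> msupport \<mu>"
    using F(1) closure_minimal[OF assms(2) closed_msupport] by blast
  define c where "c = Min (insert 1 ((\<lambda>b. measure \<mu> (ball b (r / 2))) ` F))"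
  have "c > 0"
    unfolding c_def using F(2) supp assms(3)
    by (subst Min_gr_iff) (auto intro!: measure_pos_if_meets_msupport)
  moreover have "c \<le> measure \<mu> (ball a r)" if "a \<in> A" for a
  proof -
    have "a \<in> closure A" using that closure_subset by blast
    then obtain b where b: "b \<in> F" "a \<in> ball b (r / 2)" using F(3) by blast
    have "c \<le> measure \<mu> (ball b (r / 2))" unfolding c_def using F(2) b by (intro Min_le) auto
    also have "\<dots> \<le> measure \<mu> (ball a r)"
    proof (rule finite_measure_mono)
      show "ball b (r / 2) \<subseteq> ball a r"
        using b(2) by (auto simp del: less_divide_eq_numeral1 intro: dist_triangle_half_r)
    qed auto
    finally show ?thesis .
  qed
  ultimately show ?thesis using that by blast
qed

lemma mass_pos:
  fixes x :: "'a ^ 'n::finite"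
  assumes "inj (\<lambda>i. x $ i)" "x $ i \<in> msupport \<mu>"
  shows "0 < mass x i"
  unfolding mass_def
  by (rule measure_pos_if_meets_msupport[OF open_open_cell mem_open_cell_self[OF assms(1)] assms(2)])

lemma moment_eq_lloyd: "0 < mass x i \<Longrightarrow> moment x i = mass x i *\<^sub>R lloyd x $ i"
  by (simp add: lloyd_def)

lemma defect_eq_lloyd: "0 < mass x i \<Longrightarrow> defect x i = mass x i *\<^sub>R (x $ i - lloyd x $ i)"
  unfolding defect_def by (simp add: moment_eq_lloyd scaleR_diff_right)

text \<open>Averaging a function that is positive on the cell gives a positive value; for affine functions
this locates the centroid.\<close>

lemma lloyd_in_open_halfspace:
  fixes x :: "'a ^ 'n::finite"
  assumes "0 < mass x i" "AE \<xi> in \<mu>. \<xi> \<in> open_cell x i \<longrightarrow> 0 < c + v \<bullet> \<xi>"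
  shows "0 < c + v \<bullet> lloyd x $ i"
proof -
  let ?f = "\<lambda>\<xi>. indicator (open_cell x i) \<xi> * (c + v \<bullet> \<xi>)"
  have nonneg: "AE \<xi> in \<mu>. 0 \<le> ?f \<xi>"
    using assms(2) by (rule AE_mp) (auto simp: indicator_def)
  have "(\<integral>\<xi>. ?f \<xi> \<partial>\<mu>) \<noteq> 0"
  proof
    assume "(\<integral>\<xi>. ?f \<xi> \<partial>\<mu>) = 0"
    then have "AE \<xi> in \<mu>. ?f \<xi> = 0"
      using integral_nonneg_eq_0_iff_AE[OF integral_cell_affine(1) nonneg] by simp
    then have "AE \<xi> in \<mu>. \<xi> \<notin> open_cell x i"
      using assms(2) by eventually_elim (auto simp: indicator_def)
    then have "mass x i = 0"
      unfolding mass_def by (subst measure_eq_AE[of _ "{}"]) auto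
    with assms(1) show False by simp
  qed
  moreover have "0 \<le> (\<integral>\<xi>. ?f \<xi> \<partial>\<mu>)" by (rule integral_nonneg_AE[OF nonneg])
  moreover have "(\<integral>\<xi>. ?f \<xi> \<partial>\<mu>) = mass x i * (c + v \<bullet> lloyd x $ i)"
    unfolding integral_cell_affine moment_eq_lloyd[OF assms(1)] by (simp add: algebra_simps)
  ultimately show ?thesis using assms(1) by (simp add: zero_le_mult_iff)
qed

text \<open>The open cell is an intersection of open half-spaces, so it contains its own centroid. As the cells
are disjoint, the new points are again distinct.\<close>

lemma lloyd_in_open_cell:
  fixes x :: "'a ^ 'n::finite"
  assumes "0 < mass x i"
  shows "lloyd x $ i \<in> open_cell x i"
proof -
  have eq: "(norm (\<xi> - x $ j))\<^sup>2 - (norm (\<xi> - x $ i))\<^sup>2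
      = ((norm (x $ j))\<^sup>2 - (norm (x $ i))\<^sup>2) + (2 *\<^sub>R (x $ i - x $ j)) \<bullet> \<xi>" for \<xi> j
    by (simp add: power2_norm_eq_inner inner_diff_left inner_diff_right inner_commute algebra_simps)
  have "norm (lloyd x $ i - x $ i) < norm (lloyd x $ i - x $ j)" if "j \<noteq> i" for j
  proof -
    have "0 < ((norm (x $ j))\<^sup>2 - (norm (x $ i))\<^sup>2) + (2 *\<^sub>R (x $ i - x $ j)) \<bullet> lloyd x $ i"
      by (rule lloyd_in_open_halfspace[OF assms], fold eq)
        (use that in \<open>auto simp: open_cell_def intro!: AE_I2 power_strict_mono\<close>)
    then show ?thesis by (fold eq) (simp add: power_less_imp_less_base)
  qed
  then show ?thesis unfolding open_cell_def by blast
qed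

lemma inj_lloyd:
  fixes x :: "'a ^ 'n::finite"
  assumes "\<And>i. 0 < mass x i"
  shows "inj (\<lambda>i. lloyd x $ i)"
  by (rule injI) (metis lloyd_in_open_cell[OF assms] open_cell_disjoint)

lemma lloyd_in_msupport:
  fixes x :: "'a ^ 'n::finite"
  assumes "convex (msupport \<mu>)" "0 < mass x i"
  shows "lloyd x $ i \<in> msupport \<mu>"
proof (rule ccontr)
  assume "lloyd x $ i \<notin> msupport \<mu>"
  then obtain a b where ab: "a \<bullet> lloyd x $ i < b" "\<forall>\<xi>\<in>msupport \<mu>. b < a \<bullet> \<xi>"
    using separating_hyperplane_closed_point[OF assms(1) closed_msupport] by blast
  have "0 < - b + a \<bullet> lloyd x $ i"
    by (rule lloyd_in_open_halfspace[OF assms(2) AE_mp[OF AE_in_msupport[OF sets_eq_borel]]])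
      (use ab(2) in auto)
  with ab(1) show False by simp
qed

text \<open>At \<open>z = lloyd x\<close> the linear part of the quadratic bound is minus twice the quadratic part.\<close>

lemma energy_lloyd_le:
  fixes x :: "'a ^ 'n::finite"
  assumes "inj (\<lambda>i. x $ i)" "\<And>i. 0 < mass x i"
  shows "energy (grid (lloyd x)) + (\<Sum>i\<in>UNIV. mass x i * (norm (lloyd x $ i - x $ i))\<^sup>2) \<le> energy (grid x)"
proof -
  have "mass x i * (norm (lloyd x $ i - x $ i))\<^sup>2 + 2 * ((lloyd x $ i - x $ i) \<bullet> defect x i)
      = - (mass x i * (norm (lloyd x $ i - x $ i))\<^sup>2)" for i
  proof -
    have "(lloyd x $ i - x $ i) \<bullet> defect x i = - (mass x i * (norm (lloyd x $ i - x $ i))\<^sup>2)"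
      unfolding defect_eq_lloyd[OF assms(2)] power2_norm_eq_inner
      by (simp add: inner_diff_left inner_diff_right algebra_simps)
    then show ?thesis by simp
  qed
  then show ?thesis
    using energy_le_quadratic[OF assms(1), of "lloyd x"] by (simp only: sum_negf)
qed

lemma lloyd_fixed_point_critical:
  fixes y :: "'a ^ 'n::finite"
  assumes "inj (\<lambda>i. y $ i)" "\<And>i. 0 < mass y i" "lloyd y = y"
  shows "GDERIV (\<lambda>x. energy (grid x)) y :> 0"
proof -
  have "(\<chi> i. 2 *\<^sub>R defect y i) = 0"
    by (simp add: vec_eq_iff defect_eq_lloyd[OF assms(2)] assms(3))
  then show ?thesis using GDERIV_energy[OF assms(1)] by simp
qed

lemma isCont_energy:
  fixes y :: "'a ^ 'n::finite"
  shows "inj (\<lambda>i. y $ i) \<Longrightarrow> isCont (\<lambda>x. energy (grid x)) y"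
  using has_derivative_continuous GDERIV_energy unfolding gderiv_def by blast

lemma isCont_lloyd:
  fixes y :: "'a ^ 'n::finite"
  assumes "inj (\<lambda>i. y $ i)" "0 < mass y i"
  shows "isCont (\<lambda>x. lloyd x $ i) y"
  unfolding lloyd_def vec_lambda_beta
  using assms by (intro continuous_intros isCont_mass isCont_moment) auto

end

section \<open>Descent along Lloyd iterates\<close>

text \<open>The recursion is required only at tuples of distinct points in the support, because there the
centroids of any choice of Voronoi cells agree with the Lloyd map; all iterates turn out to be of this
kind.\<close>

locale lloyd_sequence = hyperplane_free_law \<mu> for \<mu> :: "'a::euclidean_space measure" +
  fixes x :: "nat \<Rightarrow> 'a ^ 'n::finite"
  assumes convex_msupport: "convex (msupport \<mu>)"
    and inj_start: "inj (\<lambda>i. x 0 $ i)"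
    and start_in_msupport: "x 0 $ i \<in> msupport \<mu>"
    and iterate_if_admissible:
      "inj (\<lambda>i. x k $ i) \<Longrightarrow> (\<And>i. x k $ i \<in> msupport \<mu>) \<Longrightarrow> x (Suc k) = lloyd (x k)"
begin

lemma iterate_invariant: "inj (\<lambda>i. x k $ i) \<and> (\<forall>i. x k $ i \<in> msupport \<mu>)"
proof (induction k)
  case 0
  then show ?case using inj_start start_in_msupport by blast
next
  case (Suc k)
  then have "0 < mass (x k) i" for i using mass_pos by blast
  moreover have "x (Suc k) = lloyd (x k)" using Suc iterate_if_admissible by blast
  ultimately show ?case
    using inj_lloyd[of "x k"] lloyd_in_msupport[OF convex_msupport, of "x k"] by simp
qed

lemma inj_iterate: "inj (\<lambda>i. x k $ i)" and iterate_in_msupport: "x k $ i \<in> msupport \<mu>"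
  using iterate_invariant by auto

lemma iterate: "x (Suc k) = lloyd (x k)"
  by (rule iterate_if_admissible[OF inj_iterate iterate_in_msupport])

lemma mass_iterate_pos: "0 < mass (x k) i"
  using mass_pos inj_iterate iterate_in_msupport by blast

lemma energy_step:
  "energy (grid (x (Suc k))) + (\<Sum>i\<in>UNIV. mass (x k) i * (norm (x (Suc k) $ i - x k $ i))\<^sup>2) \<le> energy (grid (x k))"
  unfolding iterate by (rule energy_lloyd_le[OF inj_iterate mass_iterate_pos])

lemma decseq_energy: "decseq (\<lambda>k. energy (grid (x k)))"
proof (rule decseq_SucI)
  fix k
  have "0 \<le> (\<Sum>i\<in>UNIV. mass (x k) i * (norm (x (Suc k) $ i - x k $ i))\<^sup>2)"
    by (intro sum_nonneg mult_nonneg_nonneg mass_nonneg) auto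
  then show "energy (grid (x (Suc k))) \<le> energy (grid (x k))"
    using energy_step[of k] by linarith
qed

lemma energy_step_strict:
  assumes "x (Suc k) \<noteq> x k"
  shows "energy (grid (x (Suc k))) < energy (grid (x k))"
proof -
  obtain i where "x (Suc k) $ i \<noteq> x k $ i" using assms by (auto simp: vec_eq_iff)
  then have "0 < (\<Sum>i\<in>UNIV. mass (x k) i * (norm (x (Suc k) $ i - x k $ i))\<^sup>2)"
    using mass_iterate_pos[of k i]
    by (intro sum_pos2[of UNIV i]) (auto intro!: mult_nonneg_nonneg mass_nonneg)
  then show ?thesis using energy_step[of k] by linarith
qed

definition limit_energy :: real where
  "limit_energy = lim (\<lambda>k. energy (grid (x k)))"

lemma energy_tendsto: "(\<lambda>k. energy (grid (x k))) \<longlonglongrightarrow> limit_energy"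
proof -
  have "0 \<le> energy (grid (x k))" for k by (rule energy_nonneg) auto
  then obtain L where "(\<lambda>k. energy (grid (x k))) \<longlonglongrightarrow> L"
    using decseq_convergent[OF decseq_energy] by blast
  then show ?thesis unfolding limit_energy_def by (simp add: limI)
qed

lemma limit_energy_le: "limit_energy \<le> energy (grid (x k))"
  by (rule decseq_ge[OF decseq_energy energy_tendsto])

lemma weighted_step_tendsto_0:
  "(\<lambda>k. mass (x k) i * (norm (x (Suc k) $ i - x k $ i))\<^sup>2) \<longlonglongrightarrow> 0"
proof -
  have "(\<lambda>k. energy (grid (x k)) - energy (grid (x (Suc k)))) \<longlonglongrightarrow> limit_energy - limit_energy"
    by (intro tendsto_diff energy_tendsto LIMSEQ_Suc)
  then have drop: "(\<lambda>k. energy (grid (x k)) - energy (grid (x (Suc k)))) \<longlonglongrightarrow> 0" by simp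
  show ?thesis
  proof (rule tendsto_sandwich[OF _ _ tendsto_const drop]; intro always_eventually allI)
    fix k
    show "0 \<le> mass (x k) i * (norm (x (Suc k) $ i - x k $ i))\<^sup>2"
      by (intro mult_nonneg_nonneg mass_nonneg) auto
    have "mass (x k) i * (norm (x (Suc k) $ i - x k $ i))\<^sup>2
        \<le> (\<Sum>i\<in>UNIV. mass (x k) i * (norm (x (Suc k) $ i - x k $ i))\<^sup>2)"
      by (rule member_le_sum) (auto intro!: mult_nonneg_nonneg mass_nonneg)
    then show "mass (x k) i * (norm (x (Suc k) $ i - x k $ i))\<^sup>2
        \<le> energy (grid (x k)) - energy (grid (x (Suc k)))"
      using energy_step[of k] by linarith
  qed
qed

text \<open>By \<open>mass\<^sup>2 \<le> mass\<close> this follows from the descent. It is what can be said about the steps as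
long as cells may lose their mass, and it is the input for showing that points stay apart.\<close>

lemma mass_times_step_tendsto_0:
  "(\<lambda>k. mass (x k) i * norm (x (Suc k) $ i - x k $ i)) \<longlonglongrightarrow> 0"
proof (rule tendsto_sandwich[OF _ _ tendsto_const])
  show "(\<lambda>k. sqrt (mass (x k) i * (norm (x (Suc k) $ i - x k $ i))\<^sup>2)) \<longlonglongrightarrow> 0"
    using tendsto_real_sqrt[OF weighted_step_tendsto_0] by simp
  have "mass (x k) i * d \<le> sqrt (mass (x k) i * d\<^sup>2)" if "0 \<le> d" for k d
  proof (rule real_le_rsqrt)
    have "(mass (x k) i * d)\<^sup>2 = (mass (x k) i * mass (x k) i) * d\<^sup>2" by (simp add: power2_eq_square)
    also have "\<dots> \<le> (mass (x k) i * 1) * d\<^sup>2"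
      by (intro mult_right_mono mult_left_mono mass_le_1 mass_nonneg) auto
    finally show "(mass (x k) i * d)\<^sup>2 \<le> mass (x k) i * d\<^sup>2" by simp
  qed
  then show "eventually (\<lambda>k. mass (x k) i * norm (x (Suc k) $ i - x k $ i)
      \<le> sqrt (mass (x k) i * (norm (x (Suc k) $ i - x k $ i))\<^sup>2)) sequentially" by simp
qed (auto simp: mass_nonneg)

end

section \<open>Points of the grid do not merge\<close>

lemma bounded_range_vec:
  fixes z :: "'b \<Rightarrow> 'a::real_normed_vector ^ 'n::finite"
  assumes "\<And>i. bounded (range (\<lambda>t. z t $ i))"
  shows "bounded (range z)"
proof -
  obtain B where B: "\<And>i t. norm (z t $ i) \<le> B i"
    using assms unfolding bounded_iff by (auto, metis)
  have "norm (z t) \<le> (\<Sum>i\<in>UNIV. B i)" for t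
    unfolding norm_vec_def
    by (rule order_trans[OF L2_set_le_sum sum_mono]) (auto simp: B)
  then show ?thesis unfolding bounded_iff by auto
qed

context hyperplane_free_law
begin

text \<open>The set where \<open>\<bar>f\<bar>\<close> is below a threshold has small measure, and outside it the measure of \<open>A n\<close> is
controlled by Markov's inequality.\<close>

lemma measure_tendsto_0_if_integral:
  fixes f :: "'a \<Rightarrow> real"
  assumes f: "integrable \<mu> f" and nz: "AE \<xi> in \<mu>. f \<xi> \<noteq> 0"
    and [measurable]: "\<And>n. A n \<in> sets borel"
    and lim: "(\<lambda>n. \<integral>\<xi>. indicator (A n) \<xi> * \<bar>f \<xi>\<bar> \<partial>\<mu>) \<longlonglongrightarrow> 0"
  shows "(\<lambda>n. measure \<mu> (A n)) \<longlonglongrightarrow> 0"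
proof (rule order_tendstoI)
  have [measurable]: "f \<in> borel_measurable borel"
    using f by (auto dest: borel_measurable_integrable)
  fix e :: real assume "0 < e"
  define S where "S k = {\<xi>. \<bar>f \<xi>\<bar> < inverse (real (Suc k))}" for k
  have [measurable]: "S k \<in> sets borel" for k unfolding S_def by measurable
  have "(\<lambda>k. measure \<mu> (S k)) \<longlonglongrightarrow> measure \<mu> (\<Inter>k. S k)"
  proof (rule finite_Lim_measure_decseq)
    show "decseq S"
      unfolding S_def decseq_def by (auto elim!: less_le_trans intro!: le_imp_inverse_le)
  qed auto
  also have "measure \<mu> (\<Inter>k. S k) = 0"
  proof -
    have "AE \<xi> in \<mu>. \<xi> \<notin> (\<Inter>k. S k)"
      using nz
    proof eventually_elim
      case (elim \<xi>)
      then obtain k where "inverse (real (Suc k)) < \<bar>f \<xi>\<bar>"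
        using reals_Archimedean[of "\<bar>f \<xi>\<bar>"] by auto
      then show ?case unfolding S_def by (auto intro!: exI[of _ k])
    qed
    then show ?thesis by (subst measure_eq_AE[of _ "{}"]) auto
  qed
  finally have "eventually (\<lambda>k. measure \<mu> (S k) < e / 2) sequentially"
    using \<open>0 < e\<close> by (intro order_tendstoD(2)) auto
  then obtain K where K: "measure \<mu> (S K) < e / 2" by (auto simp: eventually_sequentially)
  have int: "integrable \<mu> (\<lambda>\<xi>. indicator (A n) \<xi> * \<bar>f \<xi>\<bar>)" for n
    using integrable_mult_indicator[of "A n" \<mu> "\<lambda>\<xi>. \<bar>f \<xi>\<bar>"] f by auto
  have bound: "measure \<mu> (A n) \<le> measure \<mu> (S K) + real (Suc K) * (\<integral>\<xi>. indicator (A n) \<xi> * \<bar>f \<xi>\<bar> \<partial>\<mu>)" for n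
  proof -
    have intS: "integrable \<mu> (indicator (S K) :: 'a \<Rightarrow> real)"
      by (intro integrable_real_indicator) (auto simp: emeasure_eq_measure)
    have "(\<integral>\<xi>. indicator (A n) \<xi> \<partial>\<mu>)
        \<le> (\<integral>\<xi>. indicator (S K) \<xi> + real (Suc K) * (indicator (A n) \<xi> * \<bar>f \<xi>\<bar>) \<partial>\<mu>)"
    proof (rule integral_mono)
      show "integrable \<mu> (indicator (A n) :: 'a \<Rightarrow> real)"
        by (intro integrable_real_indicator) (auto simp: emeasure_eq_measure)
      show "integrable \<mu> (\<lambda>\<xi>. indicator (S K) \<xi> + real (Suc K) * (indicator (A n) \<xi> * \<bar>f \<xi>\<bar>))"
        by (intro Bochner_Integration.integrable_add integrable_mult_right intS int)
      fix \<xi>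
      show "indicator (A n) \<xi> \<le> indicator (S K) \<xi> + real (Suc K) * (indicator (A n) \<xi> * \<bar>f \<xi>\<bar>)"
        unfolding S_def by (auto simp: indicator_def not_less field_simps)
    qed
    also have "\<dots> = (\<integral>\<xi>. indicator (S K) \<xi> \<partial>\<mu>) + real (Suc K) * (\<integral>\<xi>. indicator (A n) \<xi> * \<bar>f \<xi>\<bar> \<partial>\<mu>)"
      using intS int by (subst Bochner_Integration.integral_add) auto
    finally show ?thesis by simp
  qed
  have "(\<lambda>n. measure \<mu> (S K) + real (Suc K) * (\<integral>\<xi>. indicator (A n) \<xi> * \<bar>f \<xi>\<bar> \<partial>\<mu>)) \<longlonglongrightarrow> measure \<mu> (S K) + real (Suc K) * 0"
    by (intro tendsto_intros lim)
  then have "eventually (\<lambda>n. measure \<mu> (S K) + real (Suc K) * (\<integral>\<xi>. indicator (A n) \<xi> * \<bar>f \<xi>\<bar> \<partial>\<mu>) < e) sequentially"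
    by (rule order_tendstoD(2)) (use K \<open>0 < e\<close> in simp)
  then show "eventually (\<lambda>n. measure \<mu> (A n) < e) sequentially"
    by (rule eventually_mono) (use bound le_less_trans in blast)
next
  fix e :: real assume "e < 0"
  then show "eventually (\<lambda>n. e < measure \<mu> (A n)) sequentially"
    by (intro always_eventually allI) (meson less_le_trans measure_nonneg)
qed

end

context lloyd_sequence
begin

text \<open>Here \<open>w n\<close> is the midpoint of \<open>x\<^sub>i\<close> and \<open>x\<^sub>j\<close> and \<open>v n\<close> the direction of \<open>x\<^sub>i - x\<^sub>j\<close>, so that
\<open>g n\<close> is the signed distance to their bisector, restricted to the cell of \<open>x\<^sub>i\<close>; \<open>f\<close> is the signed
distance to the limit of these bisectors. The integral of \<open>g n\<close> is
\<open>mass\<^sub>i\<close> times the signed distance of the next iterate to the bisector, which tends to \<open>0\<close>; and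
replacing the bisector by its limit costs only the integral of \<open>c n\<close>, which tends to \<open>0\<close> too.\<close>

lemma colliding_point_loses_mass:
  assumes s: "filterlim s sequentially sequentially" and y: "(\<lambda>n. x (s n)) \<longlonglongrightarrow> y"
    and u: "(\<lambda>n. sgn (x (s n) $ i - x (s n) $ j)) \<longlonglongrightarrow> u"
    and ij: "i \<noteq> j" "y $ i = y $ j"
  shows "(\<lambda>n. mass (x (s n)) i) \<longlonglongrightarrow> 0"
proof -
  define b where "b = y $ i"
  define v where "v n = sgn (x (s n) $ i - x (s n) $ j)" for n
  define w where "w n = (1 / 2) *\<^sub>R (x (s n) $ i + x (s n) $ j)" for n
  define A where "A n = open_cell (x (s n)) i" for n
  define f where "f \<xi> = - (u \<bullet> b) + u \<bullet> \<xi>" for \<xi>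
  define g where "g n \<xi> = indicator (A n) \<xi> * (- (v n \<bullet> w n) + v n \<bullet> \<xi>)" for n \<xi>
  have distinct: "x (s n) $ i \<noteq> x (s n) $ j" for n using inj_iterate ij(1) by (auto dest: injD)
  have vu: "v \<longlonglongrightarrow> u" unfolding v_def by (rule u)
  have "(\<lambda>n. norm (v n)) \<longlonglongrightarrow> norm u" by (intro tendsto_norm vu)
  then have "norm u = 1"
    using distinct by (simp add: v_def norm_sgn LIMSEQ_const_iff)
  then have "u \<noteq> 0" by auto
  have "w \<longlonglongrightarrow> (1 / 2) *\<^sub>R (y $ i + y $ j)" unfolding w_def by (intro tendsto_intros y)
  also have "(1 / 2) *\<^sub>R (y $ i + y $ j) = b"
    by (simp add: b_def ij(2)[symmetric] scaleR_2[symmetric] del: scaleR_2)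
  finally have wb: "w \<longlonglongrightarrow> b" .
  have g_nonneg: "0 \<le> g n \<xi>" for n \<xi>
  proof (cases "\<xi> \<in> A n")
    case True
    have "0 \<le> (norm (\<xi> - x (s n) $ j))\<^sup>2 - (norm (\<xi> - x (s n) $ i))\<^sup>2"
      using True ij(1) unfolding A_def open_cell_def by (auto intro!: power_mono less_imp_le)
    also have "\<dots> = 2 * ((x (s n) $ i - x (s n) $ j) \<bullet> (\<xi> - w n))"
      unfolding w_def
      by (simp add: power2_norm_eq_inner inner_diff_left inner_diff_right inner_add_left
          inner_add_right inner_commute algebra_simps)
    finally have "0 \<le> (x (s n) $ i - x (s n) $ j) \<bullet> (\<xi> - w n)" by simp
    then have "0 \<le> v n \<bullet> (\<xi> - w n)" unfolding v_def sgn_div_norm by simp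
    then show ?thesis using True unfolding g_def by (simp add: inner_diff_right)
  qed (simp add: g_def)
  have g_int: "integrable \<mu> (g n)" for n unfolding g_def A_def by (rule integral_cell_affine)
  have g_val: "(\<integral>\<xi>. g n \<xi> \<partial>\<mu>) = v n \<bullet> (mass (x (s n)) i *\<^sub>R (x (Suc (s n)) $ i - w n))" for n
    unfolding g_def A_def integral_cell_affine moment_eq_lloyd[OF mass_iterate_pos] iterate
    by (simp add: inner_diff_right algebra_simps)
  have g_lim: "(\<lambda>n. \<integral>\<xi>. g n \<xi> \<partial>\<mu>) \<longlonglongrightarrow> 0"
  proof (rule tendsto_sandwich[OF _ _ tendsto_const])
    show "(\<lambda>n. mass (x (s n)) i * norm (x (Suc (s n)) $ i - x (s n) $ i) + norm (x (s n) $ i - w n)) \<longlonglongrightarrow> 0"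
    proof -
      have "(\<lambda>n. x (s n) $ i - w n) \<longlonglongrightarrow> y $ i - b" by (intro tendsto_intros y wb)
      then have "(\<lambda>n. norm (x (s n) $ i - w n)) \<longlonglongrightarrow> 0"
        by (intro tendsto_norm_zero) (simp add: b_def)
      then show ?thesis
        using tendsto_add[OF filterlim_compose[OF mass_times_step_tendsto_0 s]] by fastforce
    qed
    show "eventually (\<lambda>n. (\<integral>\<xi>. g n \<xi> \<partial>\<mu>)
        \<le> mass (x (s n)) i * norm (x (Suc (s n)) $ i - x (s n) $ i) + norm (x (s n) $ i - w n)) sequentially"
    proof (intro always_eventually allI)
      fix n
      let ?m = "mass (x (s n)) i"
      have "(\<integral>\<xi>. g n \<xi> \<partial>\<mu>) \<le> norm (v n) * norm (?m *\<^sub>R (x (Suc (s n)) $ i - w n))"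
        unfolding g_val by (rule norm_cauchy_schwarz)
      also have "\<dots> = ?m * norm ((x (Suc (s n)) $ i - x (s n) $ i) + (x (s n) $ i - w n))"
        using distinct mass_nonneg[of "x (s n)" i] by (simp add: v_def norm_sgn)
      also have "\<dots> \<le> ?m * (norm (x (Suc (s n)) $ i - x (s n) $ i) + norm (x (s n) $ i - w n))"
        by (intro mult_left_mono norm_triangle_ineq mass_nonneg)
      also have "\<dots> \<le> ?m * norm (x (Suc (s n)) $ i - x (s n) $ i) + norm (x (s n) $ i - w n)"
        using mult_right_mono[OF mass_le_1[of "x (s n)" i], of "norm (x (s n) $ i - w n)"]
        by (simp add: algebra_simps)
      finally show "(\<integral>\<xi>. g n \<xi> \<partial>\<mu>)
        \<le> ?m * norm (x (Suc (s n)) $ i - x (s n) $ i) + norm (x (s n) $ i - w n)" .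
    qed
  qed (auto intro!: always_eventually Bochner_Integration.integral_nonneg g_nonneg)
  have f_int: "integrable \<mu> f"
    unfolding f_def by (intro Bochner_Integration.integrable_add integrable_inner_right) auto
  have "(\<lambda>n. measure \<mu> (A n)) \<longlonglongrightarrow> 0"
  proof (rule measure_tendsto_0_if_integral[OF f_int])
    show "AE \<xi> in \<mu>. f \<xi> \<noteq> 0"
      using AE_off_hyperplane[OF \<open>u \<noteq> 0\<close>, of "u \<bullet> b"] unfolding f_def by (rule AE_mp) simp
    define c where "c n \<xi> = norm (u - v n) * norm \<xi> + \<bar>v n \<bullet> w n - u \<bullet> b\<bar>" for n and \<xi> :: 'a
    have c_int: "integrable \<mu> (c n)" for n
      unfolding c_def by (intro Bochner_Integration.integrable_add integrable_mult_right integrable_norm) auto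
    have bound: "indicator (A n) \<xi> * \<bar>f \<xi>\<bar> \<le> g n \<xi> + c n \<xi>" for n \<xi>
    proof (cases "\<xi> \<in> A n")
      case True
      have "f \<xi> = g n \<xi> + ((u - v n) \<bullet> \<xi> + (v n \<bullet> w n - u \<bullet> b))"
        using True unfolding f_def g_def by (simp add: inner_diff_left)
      moreover have "\<bar>(u - v n) \<bullet> \<xi>\<bar> \<le> norm (u - v n) * norm \<xi>" by (rule Cauchy_Schwarz_ineq2)
      ultimately show ?thesis using True g_nonneg[of n \<xi>] unfolding c_def by simp
    qed (use g_nonneg in \<open>simp add: c_def\<close>)
    have "(\<lambda>n. (\<integral>\<xi>. g n \<xi> \<partial>\<mu>) + (norm (u - v n) * (\<integral>\<xi>. norm \<xi> \<partial>\<mu>) + \<bar>v n \<bullet> w n - u \<bullet> b\<bar>))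
       \<longlonglongrightarrow> 0 + (norm (u - u) * (\<integral>\<xi>. norm \<xi> \<partial>\<mu>) + \<bar>u \<bullet> b - u \<bullet> b\<bar>)"
      by (intro tendsto_intros g_lim vu wb)
    then have lim: "(\<lambda>n. (\<integral>\<xi>. g n \<xi> \<partial>\<mu>) + (norm (u - v n) * (\<integral>\<xi>. norm \<xi> \<partial>\<mu>) + \<bar>v n \<bullet> w n - u \<bullet> b\<bar>)) \<longlonglongrightarrow> 0"
      by simp
    show "(\<lambda>n. \<integral>\<xi>. indicator (A n) \<xi> * \<bar>f \<xi>\<bar> \<partial>\<mu>) \<longlonglongrightarrow> 0"
    proof (rule tendsto_sandwich[OF _ _ tendsto_const lim]; intro always_eventually allI)
      fix n
      have "integrable \<mu> (\<lambda>\<xi>. indicator (A n) \<xi> * \<bar>f \<xi>\<bar>)"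
        using integrable_mult_indicator[of "A n" \<mu> "\<lambda>\<xi>. \<bar>f \<xi>\<bar>"] f_int by (auto simp: A_def)
      then have "(\<integral>\<xi>. indicator (A n) \<xi> * \<bar>f \<xi>\<bar> \<partial>\<mu>) \<le> (\<integral>\<xi>. g n \<xi> + c n \<xi> \<partial>\<mu>)"
        by (intro integral_mono Bochner_Integration.integrable_add g_int c_int bound)
      also have "\<dots> = (\<integral>\<xi>. g n \<xi> \<partial>\<mu>) + (\<integral>\<xi>. c n \<xi> \<partial>\<mu>)"
        by (intro Bochner_Integration.integral_add g_int c_int)
      also have "(\<integral>\<xi>. c n \<xi> \<partial>\<mu>) = norm (u - v n) * (\<integral>\<xi>. norm \<xi> \<partial>\<mu>) + \<bar>v n \<bullet> w n - u \<bullet> b\<bar>"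
        unfolding c_def
        by (subst Bochner_Integration.integral_add)
          (use prob_space in \<open>auto intro!: integrable_mult_right integrable_norm\<close>)
      finally show "(\<integral>\<xi>. indicator (A n) \<xi> * \<bar>f \<xi>\<bar> \<partial>\<mu>)
        \<le> (\<integral>\<xi>. g n \<xi> \<partial>\<mu>) + (norm (u - v n) * (\<integral>\<xi>. norm \<xi> \<partial>\<mu>) + \<bar>v n \<bullet> w n - u \<bullet> b\<bar>)" .
    qed (auto intro!: Bochner_Integration.integral_nonneg)
  qed (simp add: A_def)
  then show ?thesis unfolding mass_def A_def .
qed

lemma limit_in_msupport:
  assumes "(\<lambda>n. x (s n)) \<longlonglongrightarrow> y"
  shows "y $ i \<in> msupport \<mu>"
proof (rule Lim_in_closed_set[OF closed_msupport])
  show "(\<lambda>n. x (s n) $ i) \<longlonglongrightarrow> y $ i" by (intro tendsto_intros assms)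
qed (auto simp: iterate_in_msupport)

text \<open>If components of the limit coincide at a point, all the cells of the components with that limit
lose their mass, whereas together they keep covering a ball around it.\<close>

lemma limit_point_distinct:
  assumes s: "filterlim s sequentially sequentially" and y: "(\<lambda>n. x (s n)) \<longlonglongrightarrow> y"
  shows "inj (\<lambda>i. y $ i)"
proof (rule ccontr)
  assume "\<not> ?thesis"
  then obtain p q where pq: "p \<noteq> q" "y $ p = y $ q" unfolding inj_def by blast
  \<comment> \<open>All pairwise directions are collected in one bounded matrix, so that one extraction makes them all converge.\<close>
  define D :: "nat \<Rightarrow> 'a ^ 'n ^ 'n" where
    "D n = (\<chi> i j. sgn (x (s n) $ i - x (s n) $ j))" for n
  have "bounded (range D)"
    by (intro bounded_range_vec) (auto simp: D_def bounded_iff norm_sgn intro!: exI[of _ 1])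
  then obtain u and r :: "nat \<Rightarrow> nat" where r: "strict_mono r" "(D \<circ> r) \<longlonglongrightarrow> u"
    using bounded_imp_convergent_subsequence by blast
  define \<sigma> where "\<sigma> n = s (r n)" for n
  have \<sigma>: "filterlim \<sigma> sequentially sequentially"
    unfolding \<sigma>_def by (rule filterlim_compose[OF s filterlim_subseq[OF r(1)]])
  have \<sigma>y: "(\<lambda>n. x (\<sigma> n)) \<longlonglongrightarrow> y"
    using LIMSEQ_subseq_LIMSEQ[OF y r(1)] by (simp add: \<sigma>_def comp_def)
  have dir: "(\<lambda>n. sgn (x (\<sigma> n) $ i - x (\<sigma> n) $ j)) \<longlonglongrightarrow> u $ i $ j" for i j
    using tendsto_vec_nth[OF tendsto_vec_nth[OF r(2)], of i j] by (simp add: D_def \<sigma>_def)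
  define I where "I = {i. y $ i = y $ p}"
  have "(\<lambda>n. mass (x (\<sigma> n)) i) \<longlonglongrightarrow> 0" if "i \<in> I" for i
  proof -
    obtain j where "j \<noteq> i" "y $ j = y $ i"
      using pq \<open>i \<in> I\<close> unfolding I_def by (metis mem_Collect_eq)
    then show ?thesis using colliding_point_loses_mass[OF \<sigma> \<sigma>y dir] by metis
  qed
  then have "(\<lambda>n. \<Sum>i\<in>I. mass (x (\<sigma> n)) i) \<longlonglongrightarrow> (\<Sum>i\<in>I. 0)" by (intro tendsto_sum)
  then have small: "(\<lambda>n. \<Sum>i\<in>I. mass (x (\<sigma> n)) i) \<longlonglongrightarrow> 0" by simp
  \<comment> \<open>Within \<open>d / 4\<close> of \<open>y\<^sub>p\<close> and with the tuple within \<open>d / 8\<close> of \<open>y\<close>, points with index in \<open>I\<close> are at distance below \<open>3 d / 8\<close> and all others above \<open>5 d / 8\<close>.\<close>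
  obtain d where d: "d > 0" "\<And>a. a \<in> grid y \<Longrightarrow> a \<noteq> y $ p \<Longrightarrow> d \<le> dist (y $ p) a"
    using finite_set_avoid[of "grid y" "y $ p"] by auto
  have "eventually (\<lambda>n. norm (x (\<sigma> n) $ i - y $ i) < d / 8) sequentially" for i
  proof -
    have "(\<lambda>n. x (\<sigma> n) $ i) \<longlonglongrightarrow> y $ i" by (intro tendsto_intros \<sigma>y)
    then show ?thesis using d(1) tendstoD[of "\<lambda>n. x (\<sigma> n) $ i" "y $ i" sequentially "d / 8"]
      unfolding dist_norm by simp
  qed
  then have "eventually (\<lambda>n. \<forall>i. norm (x (\<sigma> n) $ i - y $ i) < d / 8) sequentially"
    by (rule eventually_all_finite)
  then have "eventually (\<lambda>n. measure \<mu> (ball (y $ p) (d / 4)) \<le> (\<Sum>i\<in>I. mass (x (\<sigma> n)) i)) sequentially"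
  proof (rule eventually_mono)
    fix n assume close: "\<forall>i. norm (x (\<sigma> n) $ i - y $ i) < d / 8"
    have "AE \<xi> in \<mu>. \<xi> \<in> ball (y $ p) (d / 4) \<longrightarrow> \<xi> \<in> (\<Union>i\<in>I. open_cell (x (\<sigma> n)) i)"
      using AE_in_open_cell[OF inj_iterate[of "\<sigma> n"]]
    proof eventually_elim
      case (elim \<xi>)
      show ?case
      proof
        assume \<xi>: "\<xi> \<in> ball (y $ p) (d / 4)"
        obtain j where j: "\<xi> \<in> open_cell (x (\<sigma> n)) j" using elim by blast
        have "j \<in> I"
        proof (rule ccontr)
          assume "j \<notin> I"
          then have "d \<le> norm (y $ p - y $ j)" using d(2)[of "y $ j"] by (simp add: I_def dist_norm)
          moreover have "j \<noteq> p" using \<open>j \<notin> I\<close> by (auto simp: I_def)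
          then have "norm (\<xi> - x (\<sigma> n) $ j) < norm (\<xi> - x (\<sigma> n) $ p)"
            using j unfolding open_cell_def by simp
          moreover have "norm (\<xi> - x (\<sigma> n) $ p) \<le> norm (y $ p - \<xi>) + norm (x (\<sigma> n) $ p - y $ p)"
            using norm_triangle_ineq[of "y $ p - \<xi>" "x (\<sigma> n) $ p - y $ p"] by (simp add: norm_minus_commute)
          moreover have "norm (y $ p - y $ j) \<le> norm (y $ p - \<xi>) + norm (\<xi> - x (\<sigma> n) $ j) + norm (x (\<sigma> n) $ j - y $ j)"
            using norm_triangle_ineq[of "y $ p - \<xi>" "\<xi> - x (\<sigma> n) $ j"]
              norm_triangle_ineq[of "y $ p - x (\<sigma> n) $ j" "x (\<sigma> n) $ j - y $ j"] by simp
          moreover have "norm (y $ p - \<xi>) < d / 4" using \<xi> by (simp add: dist_norm)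
          moreover have "norm (x (\<sigma> n) $ p - y $ p) < d / 8" "norm (x (\<sigma> n) $ j - y $ j) < d / 8"
            using close by blast+
          ultimately show False using d(1) by linarith
        qed
        with j show "\<xi> \<in> (\<Union>i\<in>I. open_cell (x (\<sigma> n)) i)" by blast
      qed
    qed
    then have "measure \<mu> (ball (y $ p) (d / 4)) \<le> measure \<mu> (\<Union>i\<in>I. open_cell (x (\<sigma> n)) i)"
      by (intro finite_measure_mono_AE) auto
    also have "\<dots> \<le> (\<Sum>i\<in>I. mass (x (\<sigma> n)) i)"
      unfolding mass_def by (rule finite_measure_subadditive_finite) auto
    finally show "measure \<mu> (ball (y $ p) (d / 4)) \<le> (\<Sum>i\<in>I. mass (x (\<sigma> n)) i)" .
  qed
  then have "measure \<mu> (ball (y $ p) (d / 4)) \<le> 0"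
    by (intro tendsto_lowerbound[OF small]) auto
  moreover have "0 < measure \<mu> (ball (y $ p) (d / 4))"
    using d(1) limit_in_msupport[OF y] by (intro measure_pos_if_meets_msupport[of _ "y $ p"]) auto
  ultimately show False by linarith
qed

end

section \<open>Limit sets of sequences with vanishing steps\<close>

text \<open>In metric spaces these are the limits along index sequences tending to infinity; the form as a
decreasing intersection of closed sets is the one that yields compactness and connectedness.\<close>

definition limit_set :: "(nat \<Rightarrow> 'a::topological_space) \<Rightarrow> 'a set" where
  "limit_set x = (\<Inter>n. closure (x ` {n..}))"

lemma limit_setE:
  fixes x :: "nat \<Rightarrow> 'a::metric_space"
  assumes "y \<in> limit_set x"
  obtains s where "filterlim s sequentially sequentially" "(\<lambda>n. x (s n)) \<longlonglongrightarrow> y"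
proof -
  have "\<exists>k\<ge>n. dist (x k) y < inverse (real (Suc n))" for n
  proof -
    have "y \<in> closure (x ` {n..})" using assms unfolding limit_set_def by blast
    then have "\<exists>z\<in>x ` {n..}. dist z y < inverse (real (Suc n))"
      unfolding closure_approachable by simp
    then show ?thesis by auto
  qed
  then obtain s where s: "s n \<ge> n" "dist (x (s n)) y < inverse (real (Suc n))" for n by metis
  have "filterlim s sequentially sequentially"
    by (rule filterlim_at_top_mono[OF filterlim_ident]) (simp add: s(1))
  moreover have "(\<lambda>n. dist (x (s n)) y) \<longlonglongrightarrow> 0"
    by (rule tendsto_sandwich[OF _ _ tendsto_const LIMSEQ_inverse_real_of_nat])
      (auto intro!: always_eventually less_imp_le s(2)[simplified])
  ultimately show ?thesis using that tendsto_dist_iff by metis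
qed

lemma limit_setI:
  fixes x :: "nat \<Rightarrow> 'a::metric_space"
  assumes "filterlim s sequentially sequentially" "(\<lambda>n. x (s n)) \<longlonglongrightarrow> y"
  shows "y \<in> limit_set x"
  unfolding limit_set_def
proof (intro INT_I)
  fix n
  have "eventually (\<lambda>k. s k \<ge> n) sequentially"
    using assms(1) unfolding filterlim_at_top by blast
  then have "eventually (\<lambda>k. x (s k) \<in> closure (x ` {n..})) sequentially"
    by (rule eventually_mono) (use closure_subset in fastforce)
  then show "y \<in> closure (x ` {n..})"
    by (rule Lim_in_closed_set[OF closed_closure _ _ assms(2)]) simp
qed

text \<open>Extraction used in arguments by contradiction: a property that fails to disappear along a bounded
sequence persists along a convergent subsequence. The index map \<open>s\<close> is exposed separately from the
strictly increasing \<open>r\<close> because \<open>P\<close> may depend on the position \<open>n\<close>.\<close>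

lemma bounded_frequently_limit_point:
  fixes x :: "nat \<Rightarrow> 'a::heine_borel"
  assumes "bounded (range x)" "\<And>n. \<exists>k\<ge>n. P n k"
  obtains s r y where "filterlim (s \<circ> r) sequentially sequentially" "strict_mono r"
    "(\<lambda>n. x (s (r n))) \<longlonglongrightarrow> y" "\<And>n. P n (s n)"
proof -
  obtain s where s: "s n \<ge> n" "P n (s n)" for n using assms(2) by metis
  have "bounded (range (\<lambda>n. x (s n)))"
    by (rule bounded_subset[OF assms(1)]) auto
  then obtain y and r :: "nat \<Rightarrow> nat" where r: "strict_mono r" "((\<lambda>n. x (s n)) \<circ> r) \<longlonglongrightarrow> y"
    using bounded_imp_convergent_subsequence by blast
  have "filterlim s sequentially sequentially"
    by (rule filterlim_at_top_mono[OF filterlim_ident]) (simp add: s(1))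
  then have "filterlim (s \<circ> r) sequentially sequentially"
    unfolding comp_def using filterlim_subseq[OF r(1)] by (rule filterlim_compose)
  then show ?thesis using that r s(2) by (auto simp: comp_def)
qed

lemma limit_set_nonempty:
  fixes x :: "nat \<Rightarrow> 'a::heine_borel"
  assumes "bounded (range x)"
  shows "limit_set x \<noteq> {}"
  by (rule bounded_frequently_limit_point[OF assms, of "\<lambda>_ _. True"])
    (auto intro!: limit_setI simp: comp_def)

lemma infdist_limit_set:
  fixes x :: "nat \<Rightarrow> 'a::heine_borel"
  assumes "bounded (range x)" "limit_set x \<subseteq> K"
  shows "(\<lambda>k. infdist (x k) K) \<longlonglongrightarrow> 0"
proof (rule ccontr)
  assume "\<not> ?thesis"
  then obtain e where e: "e > 0" "\<And>n. \<exists>k\<ge>n. infdist (x k) K \<ge> e"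
    unfolding lim_sequentially dist_real_def by (auto simp: infdist_nonneg not_less)
  obtain s r :: "nat \<Rightarrow> nat" and y where sr: "filterlim (s \<circ> r) sequentially sequentially"
      "(\<lambda>n. x (s (r n))) \<longlonglongrightarrow> y" "\<And>n. infdist (x (s n)) K \<ge> e"
    by (rule bounded_frequently_limit_point[OF assms(1), of "\<lambda>_ k. infdist (x k) K \<ge> e"])
      (use e(2) in blast)+
  have "y \<in> K" using limit_setI[OF sr(1), of x y] sr(2) assms(2) by auto
  have "(\<lambda>n. infdist (x (s (r n))) K) \<longlonglongrightarrow> infdist y K"
    by (intro tendsto_infdist sr(2))
  then have "e \<le> infdist y K"
    by (rule LIMSEQ_le_const) (use sr(3) in auto)
  with \<open>y \<in> K\<close> e(1) show False by simp
qed

lemma compact_limit_set: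
  fixes x :: "nat \<Rightarrow> 'a::heine_borel"
  assumes "bounded (range x)"
  shows "compact (limit_set x)"
proof -
  have "limit_set x \<subseteq> closure (x ` {0..})"
    unfolding limit_set_def by (rule INF_lower) simp
  then have "bounded (limit_set x)"
    by (rule bounded_subset[rotated]) (intro bounded_closure bounded_subset[OF assms], auto)
  moreover have "closed (limit_set x)" unfolding limit_set_def by auto
  ultimately show ?thesis by (simp add: compact_eq_bounded_closed)
qed

text \<open>Joining consecutive terms by segments turns each tail into a connected set, and as the segments
become short this does not change the limit set. A decreasing intersection of compact connected sets
is connected.\<close>

lemma connected_limit_set:
  fixes x :: "nat \<Rightarrow> 'a::euclidean_space"
  assumes bdd: "bounded (range x)" and step: "(\<lambda>k. x (Suc k) - x k) \<longlonglongrightarrow> 0"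
  shows "connected (limit_set x)"
proof -
  define T where "T n = closure (\<Union>k\<in>{n..}. closed_segment (x k) (x (Suc k)))" for n
  have chain: "connected (\<Union>k\<in>{n..n+m}. closed_segment (x k) (x (Suc k)))" for n m
  proof (induction m)
    case (Suc m)
    have "{n..n + Suc m} = insert (Suc (n + m)) {n..n+m}" by auto
    moreover have "x (Suc (n + m)) \<in> (\<Union>k\<in>{n..n+m}. closed_segment (x k) (x (Suc k)))"
      by (intro UN_I[of "n + m"]) auto
    ultimately show ?case
      using connected_Un[OF connected_segment(1)[of "x (Suc (n + m))" "x (Suc (Suc (n + m)))"] Suc]
        ends_in_segment by (auto simp: disjoint_iff)
  qed simp
  have "connected (\<Union>m. \<Union>k\<in>{n..n+m}. closed_segment (x k) (x (Suc k)))" for n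
  proof (rule connected_Union)
    have "x n \<in> (\<Union>k\<in>{n..n+m}. closed_segment (x k) (x (Suc k)))" for m
      by (intro UN_I[of n]) auto
    then show "\<Inter> (range (\<lambda>m. \<Union>k\<in>{n..n+m}. closed_segment (x k) (x (Suc k)))) \<noteq> {}" by blast
  qed (use chain in auto)
  moreover have "(\<Union>m. \<Union>k\<in>{n..n+m}. closed_segment (x k) (x (Suc k)))
      = (\<Union>k\<in>{n..}. closed_segment (x k) (x (Suc k)))" for n
    by (auto simp: Bex_def) (metis le_add_diff_inverse order_refl)
  ultimately have T_conn: "connected (T n)" for n
    unfolding T_def by (intro connected_imp_connected_closure) simp
  have T_compact: "compact (T n)" for n
  proof -
    have "(\<Union>k\<in>{n..}. closed_segment (x k) (x (Suc k))) \<subseteq> convex hull (range x)"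
      by (intro UN_least closed_segment_subset) (auto intro: hull_inc)
    then show ?thesis
      unfolding T_def compact_closure
      using bounded_subset bounded_convex_hull[OF bdd] by blast
  qed
  have "limit_set x = \<Inter> (range T)"
  proof
    show "limit_set x \<subseteq> \<Inter> (range T)"
      unfolding limit_set_def T_def by (intro INF_mono bexI closure_mono) auto
    show "\<Inter> (range T) \<subseteq> limit_set x"
      unfolding limit_set_def
    proof (intro subsetI INT_I)
      fix y n assume y: "y \<in> \<Inter> (range T)"
      show "y \<in> closure (x ` {n..})"
        unfolding closure_approachable
      proof (intro allI impI)
        fix e :: real assume "e > 0"
        then have "eventually (\<lambda>k. norm (x (Suc k) - x k) < e / 2) sequentially"
          using step unfolding tendsto_iff by (auto simp del: less_divide_eq_numeral1)
        then obtain m where m: "\<And>k. k \<ge> m \<Longrightarrow> norm (x (Suc k) - x k) < e / 2"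
          by (auto simp: eventually_sequentially)
        have "y \<in> T (max m n)" using y by blast
        then obtain k z where k: "k \<ge> max m n" "z \<in> closed_segment (x k) (x (Suc k))" "dist z y < e / 2"
          unfolding T_def closure_approachable using \<open>e > 0\<close> by (meson UN_E atLeast_iff half_gt_zero)
        have "dist z (x k) \<le> norm (x (Suc k) - x k)"
          using segment_bound(1)[OF k(2)] by (simp add: dist_norm)
        then have "dist (x k) y < e"
          using m[of k] k dist_triangle[of "x k" y z] by (simp add: dist_commute)
        then show "\<exists>z\<in>x ` {n..}. dist z y < e" using k(1) by auto
      qed
    qed
  qed
  moreover have "T n \<subseteq> T m" if "m \<le> n" for m n
    unfolding T_def using that by (intro closure_mono) force
  ultimately show ?thesis
    using connected_nest[of T] T_compact T_conn by metis
qed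

section \<open>Limit points of the Lloyd iterates\<close>

context lloyd_sequence
begin

lemma eventually_separated:
  assumes "bounded (range x)"
  obtains \<delta> where "\<delta> > 0" "eventually (\<lambda>k. \<forall>i j. i \<noteq> j \<longrightarrow> \<delta> \<le> norm (x k $ i - x k $ j)) sequentially"
proof (rule ccontr)
  assume "\<not> thesis"
  then have "\<not> eventually (\<lambda>k. \<forall>i j. i \<noteq> j \<longrightarrow> inverse (real (Suc n)) \<le> norm (x k $ i - x k $ j)) sequentially" for n
    using that[of "inverse (real (Suc n))"] by auto
  then have "\<exists>k\<ge>n. \<exists>i j. i \<noteq> j \<and> norm (x k $ i - x k $ j) < inverse (real (Suc n))" for n
    unfolding eventually_sequentially by (meson not_le)
  then obtain s r :: "nat \<Rightarrow> nat" and y where sr: "filterlim (s \<circ> r) sequentially sequentially" "strict_mono r"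
      "(\<lambda>n. x (s (r n))) \<longlonglongrightarrow> y"
      "\<And>n. \<exists>i j. i \<noteq> j \<and> norm (x (s n) $ i - x (s n) $ j) < inverse (real (Suc n))"
    by (rule bounded_frequently_limit_point[OF assms,
          of "\<lambda>n k. \<exists>i j. i \<noteq> j \<and> norm (x k $ i - x k $ j) < inverse (real (Suc n))"]) blast+
  have inj: "inj (\<lambda>i. y $ i)"
    by (rule limit_point_distinct[of "s \<circ> r"]) (use sr in auto)
  have "eventually (\<lambda>n. i \<noteq> j \<longrightarrow> inverse (real (Suc (r n))) < norm (x (s (r n)) $ i - x (s (r n)) $ j)) sequentially" for i j
  proof (cases "i = j")
    case False
    then have "0 < norm (y $ i - y $ j)" using inj by (auto dest: injD)
    moreover have "(\<lambda>n. norm (x (s (r n)) $ i - x (s (r n)) $ j) - inverse (real (Suc (r n)))) \<longlonglongrightarrow> norm (y $ i - y $ j) - 0"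
      by (intro tendsto_intros sr(3) filterlim_compose[OF LIMSEQ_inverse_real_of_nat filterlim_subseq[OF sr(2)]])
    ultimately have "eventually (\<lambda>n. 0 < norm (x (s (r n)) $ i - x (s (r n)) $ j) - inverse (real (Suc (r n)))) sequentially"
      by (intro order_tendstoD(1)) auto
    then show ?thesis by (rule eventually_mono) simp
  qed simp
  then have "eventually (\<lambda>n. \<forall>i j. i \<noteq> j \<longrightarrow> inverse (real (Suc (r n))) < norm (x (s (r n)) $ i - x (s (r n)) $ j)) sequentially"
    by (intro eventually_all_finite)
  then obtain n where n: "\<forall>i j. i \<noteq> j \<longrightarrow> inverse (real (Suc (r n))) < norm (x (s (r n)) $ i - x (s (r n)) $ j)"
    by (auto simp: eventually_sequentially)
  show False using sr(4)[of "r n"] n by (meson less_asym)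
qed

text \<open>Once the points are \<open>\<delta>\<close>-separated, each cell contains the ball of radius \<open>\<delta> / 2\<close> around its
point, so its mass is bounded below by compactness and can be divided out.\<close>

lemma step_tendsto_0:
  assumes "bounded (range x)"
  shows "(\<lambda>k. x (Suc k) - x k) \<longlonglongrightarrow> 0"
proof (rule vec_tendstoI)
  fix i
  obtain \<delta> where \<delta>: "\<delta> > 0" "eventually (\<lambda>k. \<forall>i j. i \<noteq> j \<longrightarrow> \<delta> \<le> norm (x k $ i - x k $ j)) sequentially"
    using eventually_separated[OF assms] by blast
  have "bounded (range (\<lambda>k. x k $ i))"
    using assms Finite_Cartesian_Product.norm_nth_le order_trans unfolding bounded_iff by (auto, blast)
  moreover have "range (\<lambda>k. x k $ i) \<subseteq> msupport \<mu>" using iterate_in_msupport by auto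
  ultimately obtain c where c: "c > 0" "\<And>a. a \<in> range (\<lambda>k. x k $ i) \<Longrightarrow> c \<le> measure \<mu> (ball a (\<delta> / 2))"
    using ball_measure_bounded_below[of "range (\<lambda>k. x k $ i)" "\<delta> / 2"] \<delta>(1) by auto
  have lim: "(\<lambda>k. (mass (x k) i * norm (x (Suc k) $ i - x k $ i)) / c) \<longlonglongrightarrow> 0"
    using tendsto_divide[OF mass_times_step_tendsto_0[of i] tendsto_const[of c]] c(1) by simp
  have "(\<lambda>k. norm (x (Suc k) $ i - x k $ i)) \<longlonglongrightarrow> 0"
  proof (rule tendsto_sandwich[OF _ _ tendsto_const lim])
    show "eventually (\<lambda>k. norm (x (Suc k) $ i - x k $ i) \<le> (mass (x k) i * norm (x (Suc k) $ i - x k $ i)) / c) sequentially"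
      using \<delta>(2)
    proof (rule eventually_mono)
      fix k assume sep: "\<forall>i j. i \<noteq> j \<longrightarrow> \<delta> \<le> norm (x k $ i - x k $ j)"
      have "c \<le> measure \<mu> (ball (x k $ i) (\<delta> / 2))" using c(2) by blast
      also have "\<dots> \<le> mass (x k) i"
        unfolding mass_def by (intro finite_measure_mono ball_subset_open_cell) (use sep in auto)
      finally show "norm (x (Suc k) $ i - x k $ i) \<le> (mass (x k) i * norm (x (Suc k) $ i - x k $ i)) / c"
        using c(1) mult_right_mono[of c "mass (x k) i" "norm (x (Suc k) $ i - x k $ i)"]
        by (simp add: le_divide_eq mult.commute)
    qed
  qed auto
  then show "(\<lambda>k. (x (Suc k) - x k) $ i) \<longlonglongrightarrow> 0 $ i"
    by (simp add: tendsto_norm_zero_iff)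
qed

text \<open>Criticality of a limit point: the Lloyd map is continuous there since its components are distinct, and
since the steps vanish it is a fixed point.\<close>

lemma limit_set_properties:
  assumes "bounded (range x)" "y \<in> limit_set x"
  shows "inj (\<lambda>i. y $ i)" "y $ i \<in> msupport \<mu>" "energy (grid y) = limit_energy"
    "GDERIV (\<lambda>x. energy (grid x)) y :> 0"
proof -
  obtain s where s: "filterlim s sequentially sequentially" "(\<lambda>n. x (s n)) \<longlonglongrightarrow> y"
    using limit_setE[OF assms(2)] by blast
  show inj: "inj (\<lambda>i. y $ i)" by (rule limit_point_distinct[OF s])
  have supp: "y $ i \<in> msupport \<mu>" for i by (rule limit_in_msupport[OF s(2)])
  then show "y $ i \<in> msupport \<mu>" .
  have "(\<lambda>n. energy (grid (x (s n)))) \<longlonglongrightarrow> energy (grid y)"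
    by (rule isCont_tendsto_compose[OF isCont_energy[OF inj] s(2)])
  then show "energy (grid y) = limit_energy"
    using LIMSEQ_unique filterlim_compose[OF energy_tendsto s(1)] by blast
  have m: "0 < mass y i" for i using mass_pos[OF inj supp] .
  have "lloyd y $ i = y $ i" for i
  proof (rule LIMSEQ_unique)
    show "(\<lambda>n. lloyd (x (s n)) $ i) \<longlonglongrightarrow> lloyd y $ i"
      by (rule isCont_tendsto_compose[OF isCont_lloyd[OF inj m] s(2)])
    have "(\<lambda>n. (x (Suc (s n)) - x (s n)) + x (s n)) \<longlonglongrightarrow> 0 + y"
      by (intro tendsto_add filterlim_compose[OF step_tendsto_0[OF assms(1)] s(1)] s(2))
    then show "(\<lambda>n. lloyd (x (s n)) $ i) \<longlonglongrightarrow> y $ i"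
      unfolding iterate using tendsto_vec_nth by fastforce
  qed
  then show "GDERIV (\<lambda>x. energy (grid x)) y :> 0"
    using lloyd_fixed_point_critical[OF inj m] by (simp add: vec_eq_iff)
qed

end

section \<open>Boundedness from the splitting condition\<close>

context hyperplane_free_law
begin

lemma integrable_shifted_norm: "integrable \<mu> (\<lambda>\<xi>. (norm \<xi> + R)\<^sup>2)"
proof -
  have "integrable \<mu> (\<lambda>\<xi>. (norm \<xi>)\<^sup>2 + 2 * R * norm \<xi> + R\<^sup>2)"
    by (intro Bochner_Integration.integrable_add integrable_mult_right square_integrable
        integrable_norm integrable_ident) auto
  then show ?thesis by (simp add: power2_sum add_ac mult_ac)
qed

lemma tail_integral_tendsto_0:
  "(\<lambda>k. \<integral>\<xi>. indicator {\<xi>. real k \<le> norm \<xi>} \<xi> * (norm \<xi> + R)\<^sup>2 \<partial>\<mu>) \<longlonglongrightarrow> 0"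
proof -
  have "(\<lambda>k. \<integral>\<xi>. indicator {\<xi>. real k \<le> norm \<xi>} \<xi> * (norm \<xi> + R)\<^sup>2 \<partial>\<mu>) \<longlonglongrightarrow> (\<integral>\<xi>. 0 \<partial>\<mu>)"
  proof (rule integral_dominated_convergence[where w = "\<lambda>\<xi>. (norm \<xi> + R)\<^sup>2"])
    show "AE \<xi> in \<mu>. (\<lambda>k. indicator {\<xi>. real k \<le> norm \<xi>} \<xi> * (norm \<xi> + R)\<^sup>2) \<longlonglongrightarrow> 0"
    proof (intro AE_I2 tendsto_eventually)
      fix \<xi> :: 'a
      obtain K where "norm \<xi> < real K" using reals_Archimedean2 by blast
      then show "eventually (\<lambda>k. indicator {\<xi>. real k \<le> norm \<xi>} \<xi> * (norm \<xi> + R)\<^sup>2 = 0) sequentially"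
        by (intro eventually_sequentiallyI[of K]) (auto simp: indicator_def)
    qed
  qed (auto simp: indicator_def integrable_shifted_norm)
  then show ?thesis by simp
qed

text \<open>If \<open>\<xi>\<close> is served by the distant \<open>x\<^sub>i\<close> although \<open>\<bar>x\<^sub>j\<bar> \<le> R\<close>, then \<open>\<bar>\<xi>\<bar>\<close> is at least
\<open>(\<bar>x\<^sub>i\<bar> - R) / 2\<close>, and serving \<open>\<xi>\<close> by \<open>x\<^sub>j\<close> instead costs at most \<open>(\<bar>\<xi>\<bar> + R)\<^sup>2\<close>. The extra energy is
thus bounded by a tail of a convergent integral, uniformly in the tuple.\<close>

lemma energy_remove_far_point:
  assumes "0 < \<epsilon>" "0 \<le> R"
  obtains B where "\<And>(x :: 'a ^ 'n::finite) i j.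
    j \<noteq> i \<Longrightarrow> norm (x $ j) \<le> R \<Longrightarrow> B < norm (x $ i) \<Longrightarrow>
    energy ((\<lambda>m. x $ m) ` (- {i})) < energy (grid x) + \<epsilon>"
proof -
  define t where "t k \<xi> = indicator {\<xi>. real k \<le> norm \<xi>} \<xi> * (norm \<xi> + R)\<^sup>2" for k and \<xi> :: 'a
  have t_int: "integrable \<mu> (t k)" for k
    unfolding t_def
    using integrable_mult_indicator[of "{\<xi>. real k \<le> norm \<xi>}" \<mu> "\<lambda>\<xi>. (norm \<xi> + R)\<^sup>2"]
    by (simp add: integrable_shifted_norm)
  have "eventually (\<lambda>k. (\<integral>\<xi>. t k \<xi> \<partial>\<mu>) < \<epsilon>) sequentially"
    unfolding t_def by (rule order_tendstoD(2)[OF tail_integral_tendsto_0 assms(1)])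
  then obtain K where K: "(\<integral>\<xi>. t K \<xi> \<partial>\<mu>) < \<epsilon>" by (auto simp: eventually_sequentially)
  have "energy ((\<lambda>m. x $ m) ` (- {i})) < energy (grid x) + \<epsilon>"
    if "j \<noteq> i" "norm (x $ j) \<le> R" "2 * real K + R < norm (x $ i)" for x :: "'a ^ 'n" and i j
  proof -
    let ?A = "(\<lambda>m. x $ m) ` (- {i})"
    have A: "finite ?A" "x $ j \<in> ?A" "?A \<noteq> {}" using that(1) by auto
    have pointwise: "sq_dist ?A \<xi> \<le> sq_dist (grid x) \<xi> + t K \<xi>" for \<xi>
    proof -
      obtain a where a: "a \<in> grid x" "sq_dist (grid x) \<xi> = (norm (\<xi> - a))\<^sup>2"
        by (rule sq_dist_attained[of "grid x" \<xi>]) auto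
      show ?thesis
      proof (cases "a \<in> ?A")
        case True
        then have "sq_dist ?A \<xi> \<le> sq_dist (grid x) \<xi>"
          using sq_dist_le[OF A(1) True, of \<xi>] a(2) by simp
        moreover have "0 \<le> t K \<xi>" unfolding t_def by simp
        ultimately show ?thesis by linarith
      next
        case False
        then have "a = x $ i" using a(1) by auto
        then have "(norm (\<xi> - x $ i))\<^sup>2 \<le> (norm (\<xi> - x $ j))\<^sup>2"
          using sq_dist_le[of "grid x" "x $ j" \<xi>] a(2) by simp
        then have "norm (\<xi> - x $ i) \<le> norm (\<xi> - x $ j)" by (simp add: power2_le_iff_abs_le)
        moreover have le: "norm (\<xi> - x $ j) \<le> norm \<xi> + R"
          using norm_triangle_ineq4[of \<xi> "x $ j"] that(2) by linarith
        moreover have "norm (x $ i) \<le> norm \<xi> + norm (\<xi> - x $ i)"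
          using norm_triangle_ineq4[of \<xi> "\<xi> - x $ i"] by simp
        ultimately have "real K \<le> norm \<xi>" using that(3) by linarith
        then have "t K \<xi> = (norm \<xi> + R)\<^sup>2" unfolding t_def by simp
        moreover have "sq_dist ?A \<xi> \<le> (norm \<xi> + R)\<^sup>2"
          by (rule order_trans[OF sq_dist_le[OF A(1,2)]]) (intro power_mono le, simp)
        moreover have "0 \<le> sq_dist (grid x) \<xi>" by (rule sq_dist_nonneg) auto
        ultimately show ?thesis by linarith
      qed
    qed
    have int: "integrable \<mu> (sq_dist (grid x))" by (rule integrable_sq_dist) auto
    have "energy ?A \<le> (\<integral>\<xi>. sq_dist (grid x) \<xi> + t K \<xi> \<partial>\<mu>)"
      unfolding energy_def
      by (intro integral_mono integrable_sq_dist[OF A(1,3)] pointwise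
          Bochner_Integration.integrable_add int t_int)
    also have "\<dots> = energy (grid x) + (\<integral>\<xi>. t K \<xi> \<partial>\<mu>)"
      unfolding energy_def by (intro Bochner_Integration.integral_add int t_int)
    finally show ?thesis using K by linarith
  qed
  then show ?thesis using that by blast
qed

text \<open>If all points were far away, at least half of the mass, lying in some ball, would be far from the
grid.\<close>

lemma some_point_in_ball:
  obtains R where "0 \<le> R"
    "\<And>x :: 'a ^ 'n::finite. energy (grid x) \<le> E \<Longrightarrow> \<exists>j. norm (x $ j) \<le> R"
proof -
  have "(\<lambda>k. measure \<mu> (ball 0 (real k))) \<longlonglongrightarrow> measure \<mu> (\<Union>k. ball 0 (real k))"
    by (rule finite_Lim_measure_incseq) (auto simp: incseq_def intro: less_le_trans)
  also have "(\<Union>k. ball (0::'a) (real k)) = UNIV"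
    by (auto intro: reals_Archimedean2)
  also have "measure \<mu> UNIV = 1" using prob_space by simp
  finally have "eventually (\<lambda>k. 1 / 2 < measure \<mu> (ball 0 (real k))) sequentially"
    by (rule order_tendstoD(1)) simp
  then obtain r :: nat where r: "1 / 2 < measure \<mu> (ball 0 (real r))"
    by (auto simp: eventually_sequentially)
  \<comment> \<open>With half of the mass in the ball of radius \<open>r\<close>, a grid farther than \<open>r + s\<close> has energy at least \<open>s\<^sup>2 / 2 > E\<close>.\<close>
  define s where "s = sqrt (2 * \<bar>E\<bar> + 2)"
  have "\<exists>j. norm (x $ j) \<le> real r + s" if E: "energy (grid x) \<le> E" for x :: "'a ^ 'n"
  proof (rule ccontr)
    assume "\<not> ?thesis"
    then have far: "real r + s < norm (x $ j)" for j by (simp add: not_le)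
    have pointwise: "indicator (ball 0 (real r)) \<xi> * s\<^sup>2 \<le> sq_dist (grid x) \<xi>" for \<xi>
    proof (cases "\<xi> \<in> ball 0 (real r)")
      case True
      obtain a where a: "a \<in> grid x" "sq_dist (grid x) \<xi> = (norm (\<xi> - a))\<^sup>2"
        by (rule sq_dist_attained[of "grid x" \<xi>]) auto
      then obtain j where "a = x $ j" by auto
      then have "s \<le> norm (\<xi> - a)"
        using far[of j] norm_triangle_ineq2[of a \<xi>] True by (simp add: norm_minus_commute)
      moreover have "0 \<le> s" unfolding s_def by simp
      ultimately show ?thesis using a(2) by (simp add: indicator_def power_mono)
    next
      case False
      then show ?thesis using sq_dist_nonneg[of "grid x" \<xi>] by simp
    qed
    have "1 / 2 * s\<^sup>2 \<le> measure \<mu> (ball 0 (real r)) * s\<^sup>2"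
      using r by (intro mult_right_mono) auto
    also have "\<dots> = (\<integral>\<xi>. indicator (ball 0 (real r)) \<xi> * s\<^sup>2 \<partial>\<mu>)" by simp
    also have "\<dots> \<le> energy (grid x)"
      unfolding energy_def
      by (intro integral_mono integrable_sq_dist pointwise integrable_mult_left integrable_real_indicator)
        (auto simp: emeasure_eq_measure)
    finally show False using E unfolding s_def by simp
  qed
  moreover have "0 \<le> real r + s" unfolding s_def by simp
  ultimately show ?thesis using that by blast
qed

text \<open>Here \<open>E'\<close> bounds from below what fewer points can achieve; the gap \<open>E' - E\<close> is the margin that the
removal of a distant point would have to cost at least.\<close>

lemma bounded_if_energy_below_fewer_points:
  fixes x :: "nat \<Rightarrow> 'a ^ 'n::finite"
  assumes "\<And>k. energy (grid (x k)) \<le> E" "E < E'" "2 \<le> CARD('n)"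
    and fewer: "\<And>A. finite A \<Longrightarrow> A \<noteq> {} \<Longrightarrow> card A \<le> CARD('n) - 1 \<Longrightarrow> E' \<le> energy A"
  shows "bounded (range x)"
proof -
  obtain R where R: "0 \<le> R" "\<And>x :: 'a ^ 'n. energy (grid x) \<le> E \<Longrightarrow> \<exists>j. norm (x $ j) \<le> R"
    using some_point_in_ball[where ?'n = 'n and E = E] by blast
  obtain B where B: "\<And>(x :: 'a ^ 'n) i j. j \<noteq> i \<Longrightarrow> norm (x $ j) \<le> R \<Longrightarrow> B < norm (x $ i) \<Longrightarrow>
    energy ((\<lambda>m. x $ m) ` (- {i})) < energy (grid x) + (E' - E)"
    using energy_remove_far_point[where ?'n = 'n and R = R and \<epsilon> = "E' - E"] assms(2) R(1) by auto
  have "norm (x k $ i) \<le> max R B" for k i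
  proof (rule ccontr)
    assume far: "\<not> ?thesis"
    obtain j where j: "norm (x k $ j) \<le> R" using R(2)[OF assms(1)] by blast
    with far have "j \<noteq> i" by auto
    then have "energy ((\<lambda>m. x k $ m) ` (- {i})) < E'"
      using B[OF \<open>j \<noteq> i\<close> j] far assms(1)[of k] by linarith
    moreover have "card ((\<lambda>m. x k $ m) ` (- {i})) \<le> CARD('n) - 1"
      by (rule order_trans[OF card_image_le]) (auto simp: Compl_eq_Diff_UNIV card_Diff_singleton)
    moreover have "(\<lambda>m. x k $ m) ` (- {i}) \<noteq> {}" using \<open>j \<noteq> i\<close> by auto
    ultimately show False using fewer[of "(\<lambda>m. x k $ m) ` (- {i})"] by simp
  qed
  then show ?thesis by (intro bounded_range_vec) (auto simp: bounded_iff)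
qed

end

section \<open>From the law back to the random vector\<close>

context hyperplane_free_law
begin

text \<open>Any admissible choice of a Voronoi partition differs from the open cells only on bisectors and outside
the support.\<close>

lemma AE_voronoi_cell_iff:
  fixes y :: "'a ^ 'n::finite"
  assumes "voronoi_partition (msupport \<mu>) (grid y) D" "inj (\<lambda>i. y $ i)"
  shows "AE \<xi> in \<mu>. \<xi> \<in> D (y $ i) \<longleftrightarrow> \<xi> \<in> open_cell y i"
  using AE_in_open_cell[OF assms(2)] AE_in_msupport[OF sets_eq_borel]
proof eventually_elim
  case (elim \<xi>)
  have near: "norm (\<xi> - y $ j) \<le> norm (\<xi> - y $ k)" if "\<xi> \<in> D (y $ j)" for j k
  proof -
    have "norm (\<xi> - y $ j) \<le> Min ((\<lambda>b. norm (\<xi> - b)) ` grid y)"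
      using assms(1) that unfolding voronoi_partition_def by blast
    also have "\<dots> \<le> norm (\<xi> - y $ k)" by (rule Min_le) auto
    finally show ?thesis .
  qed
  obtain j where j: "\<xi> \<in> open_cell y j" using elim(1) by blast
  have only: "k = j" if "\<xi> \<in> D (y $ k)" for k
    using near[OF that, of j] j unfolding open_cell_def by (auto simp: not_less[symmetric])
  have "\<xi> \<in> (\<Union>a\<in>grid y. D a)"
    using assms(1) elim(2) unfolding voronoi_partition_def by simp
  then obtain k where "\<xi> \<in> D (y $ k)" by auto
  with only have "\<xi> \<in> D (y $ j)" by blast
  with only j open_cell_disjoint[OF j] show ?case by metis
qed

end

lemma quant_error_eq_sqrt_energy:
  fixes X :: "'w \<Rightarrow> 'a::euclidean_space"
  assumes [measurable]: "X \<in> borel_measurable M" and "finite A"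
    and "hyperplane_free_law (distr M borel X)"
  shows "quant_error M X A = sqrt (hyperplane_free_law.energy (distr M borel X) A)"
proof -
  interpret hyperplane_free_law "distr M borel X" by fact
  have "energy A = (\<integral>\<omega>. sq_dist A (X \<omega>) \<partial>M)"
    unfolding energy_def by (rule integral_distr) (use assms in auto)
  then show ?thesis unfolding quant_error_def sq_dist_def by simp
qed

lemma distortion_eq_energy:
  fixes X :: "'w \<Rightarrow> 'a::euclidean_space"
  assumes [measurable]: "X \<in> borel_measurable M"
    and "hyperplane_free_law (distr M borel X)"
  shows "distortion M X = (\<lambda>x :: 'a ^ 'n::finite. hyperplane_free_law.energy (distr M borel X) (grid x))"
proof
  interpret hyperplane_free_law "distr M borel X" by fact
  fix x :: "'a ^ 'n"
  have "energy (grid x) = (\<integral>\<omega>. sq_dist (grid x) (X \<omega>) \<partial>M)"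
    unfolding energy_def by (rule integral_distr) (use assms in auto)
  then show "distortion M X x = energy (grid x)"
    unfolding distortion_def sq_dist_def by (simp add: image_image)
qed

lemma lloyd_step_eq_lloyd:
  fixes X :: "'w \<Rightarrow> 'a::euclidean_space" and y :: "'a ^ 'n::finite"
  assumes [measurable]: "X \<in> borel_measurable M"
    and law: "hyperplane_free_law (distr M borel X)"
    and sel: "voronoi_selection (msupport (distr M borel X)) C"
    and inj: "inj (\<lambda>i. y $ i)" and supp: "\<And>i. y $ i \<in> msupport (distr M borel X)"
  shows "lloyd_step M X C (grid y) (y $ i) = hyperplane_free_law.lloyd (distr M borel X) y $ i"
proof -
  interpret hyperplane_free_law "distr M borel X" by fact
  let ?D = "C (grid y) (y $ i)"
  have "finite (grid y)" "grid y \<noteq> {}" "grid y \<subseteq> msupport (distr M borel X)"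
    using supp by auto
  then have part: "voronoi_partition (msupport (distr M borel X)) (grid y) (C (grid y))"
    using sel unfolding voronoi_selection_def by blast
  then have D [measurable]: "?D \<in> sets borel" unfolding voronoi_partition_def by blast
  have AE: "AE \<xi> in distr M borel X. \<xi> \<in> ?D \<longleftrightarrow> \<xi> \<in> open_cell y i"
    by (rule AE_voronoi_cell_iff[OF part inj])
  have "measure M {\<omega> \<in> space M. X \<omega> \<in> ?D} = measure (distr M borel X) ?D"
    by (subst measure_distr) (auto simp: vimage_def Int_def conj_commute)
  also have "\<dots> = mass y i"
    unfolding mass_def by (rule measure_eq_AE[OF AE]) auto
  finally have m: "measure M {\<omega> \<in> space M. X \<omega> \<in> ?D} = mass y i" .
  have "(\<integral>\<omega>. indicator ?D (X \<omega>) *\<^sub>R X \<omega> \<partial>M) = (\<integral>\<xi>. indicator ?D \<xi> *\<^sub>R \<xi> \<partial>distr M borel X)"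
    by (subst integral_distr) auto
  also have "\<dots> = moment y i"
    unfolding moment_def
    by (rule integral_cong_AE) (use AE in \<open>auto elim!: AE_mp simp: indicator_def\<close>)
  finally show ?thesis
    using m mass_pos[OF inj supp] by (simp add: lloyd_step_def lloyd_def)
qed

text \<open>The level \<open>l\<close> is the square root of the limiting energy, and the component is the one that contains the
limit set. A Lloyd step that moves the tuple decreases the energy strictly,
and the first step does move a tuple that is not critical; this is the source of both strict inequalities for \<open>l\<close> and, in the splitting case, of
the margin that forces boundedness when the initial error equals the optimum for \<open>N - 1\<close> points.\<close>

theorem theorem2p1:
  fixes M :: "'w measure"
    and X :: "'w \<Rightarrow> real ^ 'd"
    and U \<Gamma>0 :: "(real ^ 'd) set"
    and C :: "(real ^ 'd) set \<Rightarrow> real ^ 'd \<Rightarrow> (real ^ 'd) set"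
    and \<Gamma> :: "nat \<Rightarrow> (real ^ 'd) set"
    and x :: "nat \<Rightarrow> (real ^ 'd) ^ 'n"
    and N :: nat
  assumes "prob_space M"
    and "X \<in> borel_measurable M"
    and "integrable M (\<lambda>\<omega>. (norm (X \<omega>))\<^sup>2)"
    and "U = msupport (distr M borel X)" and "convex U"
    and "charges_no_hyperplane (distr M borel X)"
    and "N = CARD('n)" and "N \<ge> 2"
    and "\<Gamma>0 \<subseteq> U" and "card \<Gamma>0 = N"
    and "voronoi_selection U C"
    and "\<Gamma> = lloyd_iterate M X C \<Gamma>0"
    and "consistent_representation M X C \<Gamma>0 x"
  shows
    "(\<forall>k. \<Gamma> k = {x k $ i | i. True} \<and> card (\<Gamma> k) = N \<and> \<Gamma> k \<subseteq> U) \<and>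
     (bounded_grids \<Gamma> \<longleftrightarrow> bounded (range x)) \<and>
     (bounded_grids \<Gamma> \<longrightarrow>
        liminf (\<lambda>k. ereal (Min {norm (x k $ i - x k $ j) | i j. i \<noteq> j})) > 0 \<and>
        (\<exists>l. l \<in> {0..quant_error M X \<Gamma>0} \<and>
             (\<not> distortion_critical M X (x 0) \<longrightarrow> l < quant_error M X \<Gamma>0) \<and>
             (\<exists>K \<in> components (critical_level_set M X U l).
                (\<lambda>k. infdist (x k) K) \<longlonglongrightarrow> 0) \<and>
             (locally_finite_set (critical_level_set M X U l :: ((real ^ 'd) ^ 'n) set) \<longrightarrow>
                (\<exists>x_lim \<in> critical_level_set M X U l. x \<longlonglongrightarrow> x_lim)) \<and>
             (quant_error M X \<Gamma>0 \<in> {min_quant_error M X N <.. min_quant_error M X (N - 1)} \<longrightarrow>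
                l \<in> {min_quant_error M X N .. min_quant_error M X (N - 1)} \<and>
                (\<not> distortion_critical M X (x 0) \<or>
                 quant_error M X \<Gamma>0 < min_quant_error M X (N - 1) \<longrightarrow>
                   l < min_quant_error M X (N - 1))))) \<and>
     (quant_error M X \<Gamma>0 \<in> {min_quant_error M X N <.. min_quant_error M X (N - 1)} \<longrightarrow>
        bounded_grids \<Gamma>)"
proof -
  note [measurable] = assms(2)
  note U = assms(4)
  interpret hyperplane_free_law "distr M borel X"
  proof (intro hyperplane_free_law.intro hyperplane_free_law_axioms.intro)
    show "prob_space (distr M borel X)" using assms(1,2) by (rule prob_space.prob_space_distr)
    show "integrable (distr M borel X) (\<lambda>\<xi>. (norm \<xi>)\<^sup>2)"
      using assms(3) by (subst integrable_distr_eq) auto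
  qed (use assms(6) in auto)
  have law: "hyperplane_free_law (distr M borel X)" by (rule hyperplane_free_law_axioms)
  have start: "grid (x 0) = \<Gamma>0" and step: "\<And>k i. x (Suc k) $ i = lloyd_step M X C (grid (x k)) (x k $ i)"
    using assms(13) unfolding consistent_representation_def by auto
  have inj0: "inj (\<lambda>i. x 0 $ i)"
    by (rule eq_card_imp_inj_on) (use start assms(7,10) in auto)
  have supp0: "x 0 $ i \<in> msupport (distr M borel X)" for i
    using start assms(9) U by auto
  have next_lloyd: "x (Suc k) = lloyd (x k)"
    if "inj (\<lambda>i. x k $ i)" "\<And>i. x k $ i \<in> msupport (distr M borel X)" for k
    using lloyd_step_eq_lloyd[OF assms(2) law _ that] assms(11) step unfolding U
    by (simp add: vec_eq_iff)
  interpret lloyd_sequence "distr M borel X" x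
    using next_lloyd assms(5) inj0 supp0 unfolding U by unfold_locales auto

  have \<Gamma>: "\<Gamma> k = grid (x k)" for k
    unfolding assms(12)
  proof (induction k)
    case 0
    then show ?case using start by simp
  next
    case (Suc k)
    then show ?case by (simp add: step image_image)
  qed
  have part0: "\<Gamma> k = {x k $ i | i. True} \<and> card (\<Gamma> k) = N \<and> \<Gamma> k \<subseteq> U" for k
    unfolding \<Gamma> U assms(7) using card_image[OF inj_iterate[of k]] iterate_in_msupport by auto

  have bdd: "bounded_grids \<Gamma> \<longleftrightarrow> bounded (range x)"
  proof
    assume "bounded_grids \<Gamma>"
    then obtain K where "compact K" and K: "\<And>k. k \<ge> 1 \<Longrightarrow> \<Gamma> k \<subseteq> K" unfolding bounded_grids_def by blast
    have "bounded (range (\<lambda>k. x k $ i))" for i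
    proof (rule bounded_subset)
      \<comment> \<open>Boundedness of the grids says nothing about the index \<open>0\<close>, whose tuple is added by hand.\<close>
      show "bounded (insert (x 0 $ i) K)" using \<open>compact K\<close> by (simp add: compact_imp_bounded)
      have "x k $ i \<in> insert (x 0 $ i) K" for k
        using K[of k] unfolding \<Gamma> by (cases k) auto
      then show "range (\<lambda>k. x k $ i) \<subseteq> insert (x 0 $ i) K" by blast
    qed
    then show "bounded (range x)" by (rule bounded_range_vec)
  next
    assume "bounded (range x)"
    then obtain B where B: "\<And>k. norm (x k) \<le> B" unfolding bounded_iff by auto
    then have "norm (x k $ i) \<le> B" for k i
      using Finite_Cartesian_Product.norm_nth_le order_trans by blast
    then show "bounded_grids \<Gamma>"
      unfolding bounded_grids_def \<Gamma> by (intro exI[of _ "cball 0 B"]) auto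
  qed

  have qe: "quant_error M X A = sqrt (energy A)" if "finite A" for A
    by (rule quant_error_eq_sqrt_energy[OF assms(2) that law])
  have qe0: "quant_error M X \<Gamma>0 = sqrt (energy (grid (x 0)))" unfolding start[symmetric] by (rule qe) simp
  have crit: "distortion_critical M X y \<longleftrightarrow> inj (\<lambda>i. y $ i) \<and> (GDERIV (\<lambda>x. energy (grid x)) y :> 0)"
    for y :: "(real ^ 'd) ^ 'n"
    unfolding distortion_critical_def distortion_eq_energy[OF assms(2) law] ..
  have moves: "x 1 \<noteq> x 0" if "\<not> distortion_critical M X (x 0)"
    using that lloyd_fixed_point_critical[OF inj_iterate mass_iterate_pos, of 0] inj_iterate[of 0]
    unfolding crit by (auto simp: iterate)
  have min_le: "min_quant_error M X n \<le> quant_error M X A" if "finite A" "1 \<le> card A" "card A \<le> n" for n A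
  proof -
    have "0 \<le> quant_error M X G" if "finite G" "1 \<le> card G" for G
      unfolding qe[OF that(1)] using that by (intro real_sqrt_ge_zero energy_nonneg) auto
    then show ?thesis
      unfolding min_quant_error_def using that by (intro cInf_lower bdd_belowI[of _ 0]) auto
  qed

  define l where "l = sqrt limit_energy"
  have l_tendsto: "(\<lambda>k. quant_error M X (\<Gamma> k)) \<longlonglongrightarrow> l"
    unfolding l_def \<Gamma> using tendsto_real_sqrt[OF energy_tendsto] by (simp add: qe)
  have l_ge: "min_quant_error M X N \<le> l"
  proof (rule LIMSEQ_le_const[OF l_tendsto], intro exI allI impI min_le)
    fix k
    show "finite (\<Gamma> k)" unfolding \<Gamma> by simp
    have "card (\<Gamma> k) = N" using part0 by blast
    then show "1 \<le> card (\<Gamma> k)" "card (\<Gamma> k) \<le> N" using assms(8) by linarith+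
  qed
  have l_nonneg: "0 \<le> l"
    unfolding l_def using LIMSEQ_le_const[OF energy_tendsto, of 0] energy_nonneg by auto
  have l_le: "l \<le> quant_error M X \<Gamma>0"
    unfolding l_def qe0 using limit_energy_le by simp
  have l_less: "l < quant_error M X \<Gamma>0" if "\<not> distortion_critical M X (x 0)"
    using le_less_trans[OF limit_energy_le energy_step_strict[of 0]] moves[OF that]
    unfolding l_def qe0 by simp

  have "liminf (\<lambda>k. ereal (Min {norm (x k $ i - x k $ j) | i j. i \<noteq> j})) > 0 \<and>
     (\<exists>K \<in> components (critical_level_set M X U l). (\<lambda>k. infdist (x k) K) \<longlonglongrightarrow> 0) \<and>
     (locally_finite_set (critical_level_set M X U l :: ((real ^ 'd) ^ 'n) set) \<longrightarrow>
        (\<exists>x_lim \<in> critical_level_set M X U l. x \<longlonglongrightarrow> x_lim))"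
    if "bounded_grids \<Gamma>"
  proof (intro conjI impI)
    have b: "bounded (range x)" using that bdd by blast
    obtain \<delta> where \<delta>: "\<delta> > 0" "eventually (\<lambda>k. \<forall>i j. i \<noteq> j \<longrightarrow> \<delta> \<le> norm (x k $ i - x k $ j)) sequentially"
      using eventually_separated[OF b] by blast
    obtain p q :: 'n where "p \<noteq> q"
      using assms(7,8) card_le_Suc0_iff_eq[of "UNIV :: 'n set"] by auto
    have "eventually (\<lambda>k. ereal \<delta> \<le> ereal (Min {norm (x k $ i - x k $ j) | i j. i \<noteq> j})) sequentially"
      using \<delta>(2)
    proof (rule eventually_mono)
      fix k assume sep: "\<forall>i j. i \<noteq> j \<longrightarrow> \<delta> \<le> norm (x k $ i - x k $ j)"
      let ?S = "{norm (x k $ i - x k $ j) | i j. i \<noteq> j}"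
      have "?S \<subseteq> (\<lambda>(i, j). norm (x k $ i - x k $ j)) ` UNIV" by auto
      then have "finite ?S" by (rule finite_subset) simp
      moreover have "?S \<noteq> {}" using \<open>p \<noteq> q\<close> by blast
      ultimately have "\<delta> \<le> Min ?S \<longleftrightarrow> (\<forall>t\<in>?S. \<delta> \<le> t)" by (rule Min_ge_iff)
      moreover have "\<forall>t\<in>?S. \<delta> \<le> t" using sep by blast
      ultimately show "ereal \<delta> \<le> ereal (Min ?S)" by simp
    qed
    then have "ereal \<delta> \<le> liminf (\<lambda>k. ereal (Min {norm (x k $ i - x k $ j) | i j. i \<noteq> j}))"
      by (rule Liminf_bounded)
    then show "liminf (\<lambda>k. ereal (Min {norm (x k $ i - x k $ j) | i j. i \<noteq> j})) > 0"
      using \<delta>(1) by (auto intro: less_le_trans[of 0 "ereal \<delta>"])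
    let ?S = "critical_level_set M X U l :: ((real ^ 'd) ^ 'n) set"
    have sub: "limit_set x \<subseteq> ?S"
      unfolding critical_level_set_def crit l_def
      using limit_set_properties[OF b] qe U by auto
    obtain y where y: "y \<in> limit_set x" using limit_set_nonempty[OF b] by blast
    have conn: "connected (limit_set x)" by (rule connected_limit_set[OF b step_tendsto_0[OF b]])
    have "limit_set x \<subseteq> connected_component_set ?S y"
      by (rule connected_component_maximal[OF y conn sub])
    then have "(\<lambda>k. infdist (x k) (connected_component_set ?S y)) \<longlonglongrightarrow> 0"
      by (rule infdist_limit_set[OF b])
    then show "\<exists>K \<in> components ?S. (\<lambda>k. infdist (x k) K) \<longlonglongrightarrow> 0"
      using y sub by (auto simp: components_def)
    show "\<exists>x_lim \<in> ?S. x \<longlonglongrightarrow> x_lim" if lf: "locally_finite_set ?S"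
    proof -
      have "finite (?S \<inter> limit_set x)"
        using lf compact_limit_set[OF b] unfolding locally_finite_set_def by blast
      then have "finite (limit_set x)" using sub by (simp add: Int_absorb1)
      then have "limit_set x = {y}" using conn y connected_finite_iff_sing[of "limit_set x"] by auto
      then have "(\<lambda>k. infdist (x k) {y}) \<longlonglongrightarrow> 0" by (intro infdist_limit_set[OF b]) simp
      then have "x \<longlonglongrightarrow> y" by (simp add: tendsto_dist_iff[of x])
      then show ?thesis using y sub by blast
    qed
  qed
  moreover have "bounded_grids \<Gamma>"
    if split: "quant_error M X \<Gamma>0 \<in> {min_quant_error M X N <.. min_quant_error M X (N - 1)}"
  proof (cases "x 1 = x 0")
    case True
    have "x k = x 0" for k
      by (induction k) (use True iterate in \<open>simp_all add: iterate\<close>)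
    then have "range x \<subseteq> {x 0}" by blast
    then show ?thesis unfolding bdd by (rule bounded_subset[rotated]) simp
  next
    case False
    define m where "m = min_quant_error M X (N - 1)"
    have "0 \<le> m" using split l_nonneg l_le unfolding m_def by auto
    have "sqrt (energy (grid (x 1))) < sqrt (energy (grid (x 0)))"
      using energy_step_strict[of 0] False by simp
    also have "\<dots> \<le> m" using split unfolding qe0 m_def by simp
    finally have less: "energy (grid (x 1)) < m\<^sup>2" using \<open>0 \<le> m\<close>
    by (metis real_sqrt_abs abs_of_nonneg real_sqrt_less_iff)
    have fewer: "m\<^sup>2 \<le> energy A" if "finite A" "A \<noteq> {}" "card A \<le> CARD('n) - 1" for A
    proof -
      have "m \<le> sqrt (energy A)"
        using min_le[of A "N - 1"] that qe[OF that(1)] assms(7) unfolding m_def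
        by (simp add: card_gt_0_iff Suc_le_eq)
      then have "m\<^sup>2 \<le> (sqrt (energy A))\<^sup>2" using \<open>0 \<le> m\<close> by (rule power_mono)
      then show ?thesis using energy_nonneg[OF that(1,2)] by simp
    qed
    have "bounded (range (\<lambda>k. x (Suc k)))"
    proof (rule bounded_if_energy_below_fewer_points[OF _ less _ fewer])
      show "energy (grid (x (Suc k))) \<le> energy (grid (x 1))" for k
        using decseqD[OF decseq_energy, of 1 "Suc k"] by simp
    qed (use assms(7,8) in auto)
    moreover have "range x = insert (x 0) (range (\<lambda>k. x (Suc k)))"
      by (auto simp: image_iff) (metis not0_implies_Suc)
    ultimately show ?thesis unfolding bdd by simp
  qed
  moreover have "l \<in> {min_quant_error M X N .. min_quant_error M X (N - 1)} \<and>
      (\<not> distortion_critical M X (x 0) \<or> quant_error M X \<Gamma>0 < min_quant_error M X (N - 1) \<longrightarrow>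
         l < min_quant_error M X (N - 1))"
    if "quant_error M X \<Gamma>0 \<in> {min_quant_error M X N <.. min_quant_error M X (N - 1)}"
    using that l_ge l_le l_less by auto
  moreover have "l \<in> {0..quant_error M X \<Gamma>0}" using l_nonneg l_le by simp
  ultimately show ?thesis using part0 bdd l_less by blast
qed

end
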